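(* Let $G$ be a finitely generated group that has a finite-index subgroup isomorphic to a finitely generated subgroup of a group $H_1\times\cdots\times H_t$, where each $H_i$ is a free product $\mathbb{Z}^{r_1}*\cdots*\mathbb{Z}^{r_m}$ of finitely many free abelian groups of finite rank. Then there exists $k\in\mathbb{N}$ such that $G$ has a finite-index subgroup $K$ (with some finite presentation generating set) that has an unbounded-error $[k,2,\widetilde{\mathbb{C}}]$-DFR.
   Context: Notation: - $\widetilde{\mathbb{C}}=\overline{\mathbb{Q}}\cup\{e^{\pi i r}:r\in\overline{\mathbb{Q}}\cap\mathbb{R}\}$, where $\overline{\mathbb{Q}}$ denotes the algebraic numbers. - $\mathrm{U}(d,\mathbb{A})$ is the set of $d\times d$ unitary matrices with entries in $\mathbb{A}$. - $\chi_\rho(g)=\mathrm{Tr}(\rho(g))$ is the character of a representation $\rho$. For a group $K=\langle S\mid R\rangle$ with $S$ finite, $k\ge1$, $d\ge 2$ and $\mathbb{A}\subseteq\mathbb{C}$, an unbounded-error $[k,d,\mathbb{A}]$-DFR for $K$ is a set $\{\rho_1,\dots,\rho_k\}$ of homomorphisms $\rho_j:K\to\mathrm{U}(d)$ such that: - for every $g\in K$ with $g\neq 1_K$ there is $j$ with $|\chi_{\rho_j}(g)|<d$; - for every $\sigma\in S\cup S^{-1}$ and every $j$, $\rho_j(\sigma)$ is a finite product of matrices in $\mathrm{U}(d,\mathbb{A})$. *)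

theory Defs
  imports
    "HOL-Analysis.Analysis"
    "HOL-Algebra.Generated_Groups"
    "HOL-Algebra.Product_Groups"
    "Jordan_Normal_Form.Schur_Decomposition"
begin

definition generating_set :: "('a, 'b) monoid_scheme \<Rightarrow> 'a set \<Rightarrow> bool" where
  "generating_set G S \<longleftrightarrow> S \<subseteq> carrier G \<and> generate G S = carrier G"

definition finitely_generated_group :: "('a, 'b) monoid_scheme \<Rightarrow> bool" where
  "finitely_generated_group G \<longleftrightarrow> group G \<and> (\<exists>S. finite S \<and> generating_set G S)"

definition finite_index_subgroup :: "'a set \<Rightarrow> ('a, 'b) monoid_scheme \<Rightarrow> bool" where
  "finite_index_subgroup H G \<longleftrightarrow> subgroup H G \<and> finite (rcosets\<^bsub>G\<^esub> H)"

text \<open>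
  The free product of a family of groups is the monoid of words whose letters are pairs
  of an index and an element of the corresponding factor, modulo the least congruence
  that deletes identity letters and multiplies adjacent letters of the same factor.
\<close>

definition free_product_words ::
    "'i set \<Rightarrow> ('i \<Rightarrow> ('a, 'b) monoid_scheme) \<Rightarrow> ('i \<times> 'a) list set" where
  "free_product_words I G = lists (SIGMA i:I. carrier (G i))"

inductive_set free_product_rel ::
    "'i set \<Rightarrow> ('i \<Rightarrow> ('a, 'b) monoid_scheme) \<Rightarrow> (('i \<times> 'a) list \<times> ('i \<times> 'a) list) set"
  for I :: "'i set" and G :: "'i \<Rightarrow> ('a, 'b) monoid_scheme" where
  refl: "w \<in> free_product_words I G \<Longrightarrow> (w, w) \<in> free_product_rel I G"
| sym: "(v, w) \<in> free_product_rel I G \<Longrightarrow> (w, v) \<in> free_product_rel I G"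
| trans: "(u, v) \<in> free_product_rel I G \<Longrightarrow> (v, w) \<in> free_product_rel I G
    \<Longrightarrow> (u, w) \<in> free_product_rel I G"
| append: "(u, u') \<in> free_product_rel I G \<Longrightarrow> (v, v') \<in> free_product_rel I G
    \<Longrightarrow> (u @ v, u' @ v') \<in> free_product_rel I G"
| one: "i \<in> I \<Longrightarrow> ([(i, \<one>\<^bsub>G i\<^esub>)], []) \<in> free_product_rel I G"
| mult: "i \<in> I \<Longrightarrow> x \<in> carrier (G i) \<Longrightarrow> y \<in> carrier (G i)
    \<Longrightarrow> ([(i, x), (i, y)], [(i, x \<otimes>\<^bsub>G i\<^esub> y)]) \<in> free_product_rel I G"

definition free_product ::
    "'i set \<Rightarrow> ('i \<Rightarrow> ('a, 'b) monoid_scheme) \<Rightarrow> ('i \<times> 'a) list set monoid" where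
  "free_product I G =
    \<lparr>carrier = free_product_words I G // free_product_rel I G,
     monoid.mult = (\<lambda>A B. \<Union>u\<in>A. \<Union>v\<in>B. free_product_rel I G `` {u @ v}),
     one = free_product_rel I G `` {[]}\<rparr>"

lemma free_product_rel_words:
  assumes "\<And>i. i \<in> I \<Longrightarrow> group (G i)" and "(u, v) \<in> free_product_rel I G"
  shows "u \<in> free_product_words I G \<and> v \<in> free_product_words I G"
  using assms(2)
proof induction
  case (one i)
  then show ?case
    using assms(1)[of i] by (auto simp: free_product_words_def group.is_monoid)
next
  case (mult i x y)
  then show ?case
    using assms(1)[of i] by (auto simp: free_product_words_def group.is_monoid monoid.m_closed)
qed (auto simp: free_product_words_def)

lemma equiv_free_product_rel:
  assumes "\<And>i. i \<in> I \<Longrightarrow> group (G i)"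
  shows "equiv (free_product_words I G) (free_product_rel I G)"
proof (rule equivI)
  show "free_product_rel I G \<subseteq> free_product_words I G \<times> free_product_words I G"
  proof
    fix p
    assume "p \<in> free_product_rel I G"
    then have "(fst p, snd p) \<in> free_product_rel I G" by simp
    with assms have "fst p \<in> free_product_words I G \<and> snd p \<in> free_product_words I G"
      by (rule free_product_rel_words)
    then show "p \<in> free_product_words I G \<times> free_product_words I G"
      by (simp add: mem_Times_iff)
  qed
  show "refl_on (free_product_words I G) (free_product_rel I G)"
    by (rule refl_onI) (rule free_product_rel.refl)
  show "sym (free_product_rel I G)"
    by (rule symI) (rule free_product_rel.sym)
  show "Relation.trans (free_product_rel I G)"
    by (rule transI) (rule free_product_rel.trans)
qed

lemma free_product_mult_class:
  assumes "\<And>i. i \<in> I \<Longrightarrow> group (G i)"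
    and u: "u \<in> free_product_words I G" and v: "v \<in> free_product_words I G"
  shows "free_product_rel I G `` {u} \<otimes>\<^bsub>free_product I G\<^esub> free_product_rel I G `` {v}
    = free_product_rel I G `` {u @ v}"
proof -
  have eq: "equiv (free_product_words I G) (free_product_rel I G)"
    using assms(1) by (rule equiv_free_product_rel)
  let ?A = "free_product_rel I G `` {u}" and ?B = "free_product_rel I G `` {v}"
    and ?C = "free_product_rel I G `` {u @ v}"
  have "free_product_rel I G `` {u' @ v'} = ?C" if "u' \<in> ?A" "v' \<in> ?B" for u' v'
  proof -
    have "(u @ v, u' @ v') \<in> free_product_rel I G"
      using that by (intro free_product_rel.append) simp_all
    then show ?thesis
      using equiv_class_eq[OF eq] by blast
  qed
  then have "(\<Union>u'\<in>?A. \<Union>v'\<in>?B. free_product_rel I G `` {u' @ v'}) = (\<Union>u'\<in>?A. \<Union>v'\<in>?B. ?C)"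
    by (intro SUP_cong HOL.refl) simp_all
  moreover have "u \<in> ?A" "v \<in> ?B"
    using u v by (auto intro: free_product_rel.refl)
  ultimately show ?thesis
    unfolding free_product_def monoid.simps by blast
qed

lemma free_product_left_inverse:
  assumes "\<And>i. i \<in> I \<Longrightarrow> group (G i)" and "w \<in> free_product_words I G"
  shows "\<exists>v\<in>free_product_words I G. (v @ w, []) \<in> free_product_rel I G"
  using assms(2)
proof (induction w)
  case Nil
  then show ?case by (intro bexI[of _ "[]"]) (auto intro: free_product_rel.refl)
next
  case (Cons a w)
  obtain i x where a: "a = (i, x)" by (cases a)
  have w: "w \<in> free_product_words I G" and i: "i \<in> I" and x: "x \<in> carrier (G i)"
    using Cons.prems by (auto simp: free_product_words_def a)
  interpret Gi: group "G i" using assms(1) i by blast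
  let ?y = "inv\<^bsub>G i\<^esub> x"
  obtain v where v: "v \<in> free_product_words I G" "(v @ w, []) \<in> free_product_rel I G"
    using Cons.IH[OF w] by blast
  have "([(i, ?y), (i, x)], [(i, \<one>\<^bsub>G i\<^esub>)]) \<in> free_product_rel I G"
    using free_product_rel.mult[of i I ?y G x] i x by simp
  then have "([(i, ?y), (i, x)], []) \<in> free_product_rel I G"
    using free_product_rel.one[OF i] by (rule free_product_rel.trans)
  from free_product_rel.append[OF free_product_rel.refl[OF v(1)]
      free_product_rel.append[OF this free_product_rel.refl[OF w]]]
  have "((v @ [(i, ?y)]) @ a # w, v @ w) \<in> free_product_rel I G"
    by (simp add: a)
  then have "((v @ [(i, ?y)]) @ a # w, []) \<in> free_product_rel I G"
    using v(2) by (rule free_product_rel.trans)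
  moreover have "v @ [(i, ?y)] \<in> free_product_words I G"
    using v(1) i x by (auto simp: free_product_words_def)
  ultimately show ?case by blast
qed

lemma group_free_product:
  assumes "\<And>i. i \<in> I \<Longrightarrow> group (G i)"
  shows "group (free_product I G)"
proof -
  let ?W = "free_product_words I G" and ?R = "free_product_rel I G"
  have eq: "equiv ?W ?R"
    using assms by (rule equiv_free_product_rel)
  have mult: "?R `` {u} \<otimes>\<^bsub>free_product I G\<^esub> ?R `` {v} = ?R `` {u @ v}"
    if "u \<in> ?W" "v \<in> ?W" for u v
    using assms that by (rule free_product_mult_class)
  have carr: "carrier (free_product I G) = ?W // ?R"
    and one: "\<one>\<^bsub>free_product I G\<^esub> = ?R `` {[]}"
    by (simp_all add: free_product_def)
  have app: "u @ v \<in> ?W" if "u \<in> ?W" "v \<in> ?W" for u v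
    using that by (auto simp: free_product_words_def)
  have nil: "[] \<in> ?W" by (simp add: free_product_words_def)
  show ?thesis
  proof (rule groupI, goal_cases)
    case (1 x y)
    then show ?case by (auto simp: carr mult app elim!: quotientE intro!: quotientI)
  next
    case 2
    then show ?case by (simp add: carr one nil quotientI)
  next
    case (3 x y z)
    then show ?case by (auto simp: carr mult app elim!: quotientE)
  next
    case (4 x)
    then show ?case by (auto simp: carr one mult nil elim!: quotientE)
  next
    case (5 x)
    then obtain w where w: "w \<in> ?W" "x = ?R `` {w}" by (auto simp: carr elim!: quotientE)
    obtain v where "v \<in> ?W" "(v @ w, []) \<in> ?R"
      using free_product_left_inverse[of I G w] assms w(1) by blast
    moreover from this have "?R `` {v @ w} = ?R `` {[]}"
      using equiv_class_eq[OF eq] by blast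
    ultimately show ?case
      using w by (intro bexI[of _ "?R `` {v}"]) (simp_all add: carr one mult quotientI)
  qed
qed

definition free_abelian_power :: "nat \<Rightarrow> (nat \<Rightarrow> int) monoid" where
  "free_abelian_power n = product_group {1..n} (\<lambda>_. integer_group)"

definition unitary_group :: "nat \<Rightarrow> complex mat monoid" where
  "unitary_group d =
    \<lparr>carrier = {U \<in> carrier_mat d d. U * mat_adjoint U = 1\<^sub>m d \<and> mat_adjoint U * U = 1\<^sub>m d},
     monoid.mult = (*),
     one = 1\<^sub>m d\<rparr>"

definition unitary_matrices_over :: "nat \<Rightarrow> complex set \<Rightarrow> complex mat set" where
  "unitary_matrices_over d A = {U \<in> carrier (unitary_group d). elements_mat U \<subseteq> A}"

definition mat_trace :: "'a::comm_monoid_add mat \<Rightarrow> 'a" where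
  "mat_trace M = (\<Sum>i<dim_row M. M $$ (i, i))"

definition rep_character :: "('g \<Rightarrow> complex mat) \<Rightarrow> 'g \<Rightarrow> complex" where
  "rep_character \<rho> g = mat_trace (\<rho> g)"

definition Ctilde :: "complex set" where
  "Ctilde = {z. algebraic z} \<union>
    {exp (complex_of_real pi * \<i> * complex_of_real r) | r. algebraic (complex_of_real r)}"

text \<open>
  A presentation of \<open>K\<close> with finite generating set enters only through the image \<open>S\<close> of
  its generators in \<open>K\<close>; no finiteness of the set of relators is required.
\<close>

definition unbounded_error_DFR ::
    "nat \<Rightarrow> nat \<Rightarrow> complex set \<Rightarrow> ('g, 'b) monoid_scheme \<Rightarrow> 'g set
      \<Rightarrow> (nat \<Rightarrow> 'g \<Rightarrow> complex mat) \<Rightarrow> bool" where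
  "unbounded_error_DFR k d A K S \<rho> \<longleftrightarrow>
    k \<ge> 1 \<and> d \<ge> 2 \<and> group K \<and> finite S \<and> generating_set K S \<and>
    (\<forall>j\<in>{1..k}. \<rho> j \<in> hom K (unitary_group d)) \<and>
    (\<forall>g\<in>carrier K. g \<noteq> \<one>\<^bsub>K\<^esub> \<longrightarrow> (\<exists>j\<in>{1..k}. cmod (rep_character (\<rho> j) g) < real d)) \<and>
    (\<forall>\<sigma>\<in>S \<union> m_inv K ` S. \<forall>j\<in>{1..k}.
      \<exists>Ms. set Ms \<subseteq> unitary_matrices_over d A \<and> \<rho> j \<sigma> = foldr (*) Ms (1\<^sub>m d))"

end

theory Submission
  imports Defs "HOL-Complex_Analysis.Complex_Analysis" "HOL-Real_Asymp.Real_Asymp"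
begin

text \<open>
  The number \<open>tau = exp (\<i> \<pi> \<surd>2)\<close> is transcendental (a case of Gelfond--Schneider). Let
  \<open>\<Delta> = diag(tau, 1)\<close>. The \<open>j\<close>-th free factor \<open>\<int>^r\<close> is sent into the torus of rotations
  conjugated by \<open>\<Delta>^j\<close>, the \<open>k\<close>-th coordinate acting as multiplication by
  \<open>(a + \<i>) / (a - \<i>)\<close> with \<open>a = 2 ^ 2 ^ k\<close>. The norms \<open>a\<^sup>2 + 1\<close> are Fermat numbers, hence
  pairwise coprime, so a nonzero exponent vector gives a rational rotation none of whose entries
  is zero. The entries of the image of a reduced word are then, up to powers of \<open>tau\<close>, values
  at \<open>tau\<close> of polynomials over \<open>\<rat>\<close>. The off-diagonal ones are nonzero polynomials, so by
  transcendence every nontrivial element of the free product has a nondiagonal image, and a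
  nondiagonal unitary matrix of size 2 has trace of modulus less than 2. One such
  representation for each direct factor gives the result for the given finite-index subgroup.

  Transcendence follows Schneider's method. If \<open>tau\<close> were algebraic, Siegel's lemma would give
  a nonzero \<open>F(z) = \<Sum> a k l z^k exp (\<i> \<pi> l z)\<close> with small integer coefficients vanishing at
  \<open>n + m \<surd>2\<close> for \<open>n, m < N\<close>. The Schwarz lemma against the Liouville inequality
  propagates the zeros to all \<open>n, m\<close>, which forces \<open>F = 0\<close>.
\<close>

section \<open>Siegel's lemma and the Liouville inequality\<close>

text \<open>Pigeonhole: the box of integer vectors with coordinates in \<open>{0..X}\<close> has
  more points than there are possible values of the linear system, so two points collide and their
  difference is a small solution.\<close>

lemma siegel_lemma:
  fixes c :: "'e \<Rightarrow> 'u \<Rightarrow> int" and A :: int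
  assumes fin: "finite E" "finite U" and U: "U \<noteq> {}" "2 * card E \<le> card U"
    and A: "A \<ge> 1" "\<And>e u. e \<in> E \<Longrightarrow> u \<in> U \<Longrightarrow> \<bar>c e u\<bar> \<le> A"
  obtains x where "\<exists>u\<in>U. x u \<noteq> 0" "\<And>u. u \<in> U \<Longrightarrow> \<bar>x u\<bar> \<le> 2 * int (card U) * A"
    "\<And>e. e \<in> E \<Longrightarrow> (\<Sum>u\<in>U. c e u * x u) = 0"
proof -
  define n where "n = card U"
  define B where "B = int n * A"
  \<comment> \<open>With this side length a value of one equation ranges over
    \<open>2 * B * X + 1 = X ^ 2 + 1\<close> integers, fewer than \<open>(X + 1) ^ 2\<close>; hence
    two unknowns per equation are enough.\<close>
  define X where "X = 2 * B"
  have n: "n \<ge> 1"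
    using fin U by (simp add: n_def Suc_leI card_gt_0_iff)
  have B: "B \<ge> 1"
    unfolding B_def using mult_mono[of 1 "int n" 1 A] n A(1) by simp
  define D where "D = (\<Pi>\<^sub>E u\<in>U. {0..X})"
  define R where "R = (\<Pi>\<^sub>E e\<in>E. {-(B*X)..B*X})"
  define f where "f = (\<lambda>x. \<lambda>e\<in>E. \<Sum>u\<in>U. c e u * x u)"
  have fD: "f ` D \<subseteq> R"
  proof
    fix y assume "y \<in> f ` D"
    then obtain x where x: "x \<in> D" "y = f x" by blast
    have "\<bar>\<Sum>u\<in>U. c e u * x u\<bar> \<le> B * X" if e: "e \<in> E" for e
    proof -
      have "\<bar>\<Sum>u\<in>U. c e u * x u\<bar> \<le> (\<Sum>u\<in>U. \<bar>c e u * x u\<bar>)" by (rule sum_abs)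
      also have "\<dots> \<le> (\<Sum>u\<in>U. A * X)"
      proof (rule sum_mono)
        fix u assume u: "u \<in> U"
        have "x u \<in> {0..X}" using x(1) u by (auto simp: D_def)
        then show "\<bar>c e u * x u\<bar> \<le> A * X"
          using A(2)[OF e u] A(1) by (auto simp: abs_mult intro!: mult_mono)
      qed
      also have "\<dots> = B * X" by (simp add: B_def n_def)
      finally show ?thesis .
    qed
    then show "y \<in> R"
      unfolding R_def x(2) f_def by (auto simp: abs_le_iff)
         (metis neg_le_iff_le minus_minus)
  qed
  have finR: "finite R" unfolding R_def using fin by (intro finite_PiE) auto
  have "card (f ` D) \<le> card R" by (rule card_mono[OF finR fD])
  also have "card R = nat (2 * B * X + 1) ^ card E"
    unfolding R_def using fin by (subst card_PiE) (auto simp: mult.assoc)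
  also have "2 * B * X + 1 = X ^ 2 + 1" by (simp add: X_def power2_eq_square)
  also have "nat (X ^ 2 + 1) ^ card E < nat (X + 1) ^ n"
  proof (cases "card E = 0")
    case True
    then show ?thesis using n B one_less_power[of "nat (X + 1)" n] by (simp add: X_def)
  next
    case False
    have "nat (X ^ 2 + 1) < nat ((X + 1) ^ 2)"
      using B by (subst nat_less_eq_zless) (auto simp: X_def power2_eq_square algebra_simps)
    then have "nat (X ^ 2 + 1) ^ card E < nat ((X + 1) ^ 2) ^ card E"
      using False by (intro power_strict_mono) auto
    also have "\<dots> = nat (X + 1) ^ (2 * card E)"
      using B by (subst nat_power_eq) (auto simp: X_def power_mult)
    also have "\<dots> \<le> nat (X + 1) ^ n"
      using B U(2) by (intro power_increasing) (auto simp: X_def n_def)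
    finally show ?thesis .
  qed
  also have "\<dots> = card D"
    unfolding D_def using fin by (subst card_PiE) (auto simp: n_def)
  finally have "\<not> inj_on f D" by (rule pigeonhole)
  then obtain x y where xy: "x \<in> D" "y \<in> D" "x \<noteq> y" "f x = f y"
    by (auto simp: inj_on_def)
  show ?thesis
  proof (rule that[of "\<lambda>u. x u - y u"])
    show "\<exists>u\<in>U. x u - y u \<noteq> 0"
      using PiE_ext[OF xy(1,2)[unfolded D_def]] xy(3) by auto
  next
    fix u assume u: "u \<in> U"
    have "x u \<in> {0..X}" "y u \<in> {0..X}" using xy u by (auto simp: D_def)
    then show "\<bar>x u - y u\<bar> \<le> 2 * int (card U) * A"
      by (auto simp: X_def B_def n_def)
  next
    fix e assume e: "e \<in> E"
    have "f x e = f y e" using xy by simp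
    then show "(\<Sum>u\<in>U. c e u * (x u - y u)) = 0"
      using e by (simp add: f_def algebra_simps sum_subtractf)
  qed
qed

text \<open>Each zero in the list contributes a factor \<open>X\<close> and shifts the coefficients
  by one. The two claims go through the induction together: a nonzero factor mixes neighbouring
  coefficients, and the lower neighbour must be known to vanish.\<close>

lemma linear_factors_lowest_coeff:
  fixes as :: "'a::idom list"
  shows "coeff (\<Prod>a\<leftarrow>as. [:- a, 1:]) (length (filter (\<lambda>a. a = 0) as))
    = (\<Prod>a\<leftarrow>filter (\<lambda>a. a \<noteq> 0) as. - a)"
    and "i < length (filter (\<lambda>a. a = 0) as) \<Longrightarrow> coeff (\<Prod>a\<leftarrow>as. [:- a, 1:]) i = 0"
proof (induction as arbitrary: i)
  case (Cons b as)
  { case 1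
    show ?case
      using Cons.IH by (cases "length (filter (\<lambda>a. a = 0) as)") (auto simp: coeff_pCons) }
  { case 2
    then show ?case
      using Cons.IH(2) by (auto simp: coeff_pCons split: nat.splits if_splits) }
qed auto

text \<open>Read the eigenvector equation in a coordinate where the eigenvector has largest
  modulus.\<close>

lemma eigenvalue_row_sum_bound:
  fixes M :: "complex mat"
  assumes M: "M \<in> carrier_mat n n" and ev: "eigenvalue M k"
    and B: "\<And>i. i < n \<Longrightarrow> (\<Sum>j<n. cmod (M $$ (i,j))) \<le> B"
  shows "cmod k \<le> B"
proof -
  obtain v where v: "v \<in> carrier_vec n" "v \<noteq> 0\<^sub>v n" "M *\<^sub>v v = k \<cdot>\<^sub>v v"
    using ev M by (auto simp: eigenvalue_def eigenvector_def)
  have "n > 0" using v by (metis bot_nat_0.not_eq_extremum carrier_vecD eq_vecI index_zero_vec(2) not_less_zero)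
  obtain i where i: "i < n" "\<And>j. j < n \<Longrightarrow> cmod (vec_index v j) \<le> cmod (vec_index v i)"
  proof -
    let ?S = "(\<lambda>j. cmod (vec_index v j)) ` {..<n}"
    have "Max ?S \<in> ?S" using \<open>n > 0\<close> by (intro Max_in) auto
    then obtain i where i: "i < n" "Max ?S = cmod (vec_index v i)" by auto
    then show ?thesis using that[of i] by (metis Max_ge finite_imageI finite_lessThan image_eqI lessThan_iff)
  qed
  have pos: "cmod (vec_index v i) > 0"
  proof (rule ccontr)
    assume "\<not> ?thesis"
    then have "vec_index v j = 0" if "j < n" for j using i(2)[OF that] by auto
    then have "v = 0\<^sub>v n" using v(1) by (intro eq_vecI) auto
    then show False using v by simp
  qed
  have "k * vec_index v i = (\<Sum>j<n. M $$ (i,j) * vec_index v j)"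
  proof -
    have "vec_index (k \<cdot>\<^sub>v v) i = vec_index (M *\<^sub>v v) i" by (simp add: v(3))
    then show ?thesis using i(1) v(1) M by (simp add: scalar_prod_def atLeast0LessThan)
  qed
  then have "cmod k * cmod (vec_index v i) \<le> (\<Sum>j<n. cmod (M $$ (i,j)) * cmod (vec_index v j))"
    by (metis (no_types, lifting) norm_mult norm_sum sum.cong)
  also have "\<dots> \<le> (\<Sum>j<n. cmod (M $$ (i,j)) * cmod (vec_index v i))"
    by (intro sum_mono mult_left_mono i(2)) auto
  also have "\<dots> = (\<Sum>j<n. cmod (M $$ (i,j))) * cmod (vec_index v i)"
    by (simp add: sum_distrib_right)
  also have "\<dots> \<le> B * cmod (vec_index v i)"
    using B[OF i(1)] by (intro mult_right_mono) auto
  finally show ?thesis using pos by simp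
qed

lemma prod_list_le_power:
  fixes f :: "'a \<Rightarrow> real"
  assumes "\<And>x. x \<in> set xs \<Longrightarrow> 0 \<le> f x \<and> f x \<le> B" "1 \<le> B" "length xs \<le> n"
  shows "(\<Prod>x\<leftarrow>xs. f x) \<le> B ^ n"
proof -
  have "0 \<le> (\<Prod>x\<leftarrow>xs. f x) \<and> (\<Prod>x\<leftarrow>xs. f x) \<le> B ^ length xs"
    using assms(1,2) by (induction xs) (auto intro!: mult_mono)
  moreover have "B ^ length xs \<le> B ^ n" using assms by (intro power_increasing) auto
  ultimately show ?thesis by linarith
qed

text \<open>The product of the nonzero eigenvalues of an integer matrix is, up to sign, the lowest
  nonzero coefficient of its characteristic polynomial, hence at least 1 in modulus.\<close>
lemma integer_matrix_eigenvalue_lower_bound: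
  fixes M :: "int mat"
  assumes M: "M \<in> carrier_mat n n" and ev: "eigenvalue (map_mat of_int M) (k::complex)" and "k \<noteq> 0"
    and B: "\<And>i. i < n \<Longrightarrow> (\<Sum>j<n. real_of_int \<bar>M $$ (i,j)\<bar>) \<le> B" "1 \<le> B"
  shows "1 \<le> cmod k * B ^ n"
proof -
  let ?M = "map_mat complex_of_int M"
  have M': "?M \<in> carrier_mat n n" using M by simp
  obtain as where as: "char_poly ?M = (\<Prod>a\<leftarrow>as. [:- a, 1:])" "length as = n"
    using char_poly_factorized[OF M'] by blast
  have ev_as: "eigenvalue ?M a \<longleftrightarrow> a \<in> set as" for a
    unfolding eigenvalue_root_char_poly[OF M'] as(1) poly_prod_list by (auto simp: prod_list_zero_iff)
  have le: "cmod a \<le> B" if "a \<in> set as" for a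
    using eigenvalue_row_sum_bound[OF M', of a B] that M B by (simp add: ev_as)
  define nz where "nz = filter (\<lambda>a. a \<noteq> 0) as"
  define z where "z = coeff (char_poly M) (length (filter (\<lambda>a. a = 0) as))"
  have "complex_of_int z = (\<Prod>a\<leftarrow>nz. - a)"
    using linear_factors_lowest_coeff(1)[of as]
    unfolding nz_def z_def as(1)[symmetric] of_int_hom.char_poly_hom[OF M] by simp
  moreover have "(\<Prod>a\<leftarrow>nz. - a) \<noteq> 0" by (auto simp: nz_def prod_list_zero_iff)
  ultimately have "z \<noteq> 0" by auto
  then have "1 \<le> cmod (complex_of_int z)" by (simp add: int_one_le_iff_zero_less)
  also have "\<dots> = (\<Prod>a\<leftarrow>nz. cmod a)"
    unfolding \<open>complex_of_int z = _\<close> by (induction nz) (auto simp: norm_mult)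
  also have "k \<in> set nz" using ev ev_as \<open>k \<noteq> 0\<close> by (auto simp: nz_def)
  then obtain xs ys where nz: "nz = xs @ k # ys" by (meson split_list)
  have "(\<Prod>a\<leftarrow>nz. cmod a) = cmod k * (\<Prod>a\<leftarrow>xs @ ys. cmod a)" by (simp add: nz)
  also have "\<dots> \<le> cmod k * B ^ n"
  proof (intro mult_left_mono prod_list_le_power)
    have "set (xs @ ys) \<subseteq> set as" using arg_cong[OF nz, of set] by (auto simp: nz_def)
    then show "0 \<le> cmod x \<and> cmod x \<le> B" if "x \<in> set (xs @ ys)" for x
      using le that by auto
    have "length nz \<le> n" by (simp add: nz_def flip: as(2))
    then show "length (xs @ ys) \<le> n" by (simp add: nz)
  qed (use B in auto)
  finally show ?thesis .
qed

section \<open>Zeros of entire functions\<close>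

text \<open>The quotient has a removable singularity at \<open>a\<close>, filled by the
  derivative.\<close>

lemma entire_divide_zero:
  assumes f: "f holomorphic_on UNIV" "f a = 0"
  obtains g where "g holomorphic_on UNIV" "\<And>z. f z = (z - a) * g z"
proof -
  define g where "g = (\<lambda>z. if z = a then deriv f a else f z / (z - a))"
  have "g holomorphic_on UNIV"
  proof (rule pole_theorem_open_0[OF f(1)])
    show "f z = (z - a) * g z" if "z \<in> UNIV - {a}" for z using that by (simp add: g_def)
  qed (auto simp: g_def f)
  moreover have "f z = (z - a) * g z" for z using f(2) by (simp add: g_def)
  ultimately show ?thesis by (rule that)
qed

lemma entire_divide_zeros:
  assumes "finite Z" "f holomorphic_on UNIV" "\<And>a. a \<in> Z \<Longrightarrow> f a = 0"
  obtains g where "g holomorphic_on UNIV" "\<And>z. f z = (\<Prod>a\<in>Z. z - a) * g z"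
  using assms
proof (induction Z arbitrary: thesis rule: finite_induct)
  case empty
  then show ?case by simp
next
  case (insert a Z)
  obtain g where g: "g holomorphic_on UNIV" "\<And>z. f z = (\<Prod>a\<in>Z. z - a) * g z"
    using insert.IH insert.prems by blast
  have "g a = 0"
    using g(2)[of a] insert.prems(3)[of a] insert.hyps by (auto simp: prod_zero_iff)
  then obtain h where h: "h holomorphic_on UNIV" "\<And>z. g z = (z - a) * h z"
    using entire_divide_zero[OF g(1)] by blast
  show ?case
    by (rule insert.prems(1)[OF h(1)]) (use insert.hyps in \<open>simp add: g(2) h(2)\<close>)
qed

text \<open>Divide out the zeros and apply the maximum principle to the quotient on the disc of
  radius \<open>7 * r\<close>. On its boundary each factor \<open>z - a\<close> has modulus at least
  \<open>6 * r\<close>, at \<open>w\<close> at most \<open>2 * r\<close>, so every zero gains a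
  factor 3.\<close>

lemma schwarz_lemma_zeros:
  assumes "finite Z" "f holomorphic_on UNIV" "\<And>a. a \<in> Z \<Longrightarrow> f a = 0"
    and r: "0 < r" "\<And>a. a \<in> Z \<Longrightarrow> cmod a \<le> r" "cmod w \<le> r"
    and B: "\<And>z. cmod z = 7 * r \<Longrightarrow> cmod (f z) \<le> B"
  shows "3 ^ card Z * cmod (f w) \<le> B"
proof -
  obtain g where g: "g holomorphic_on UNIV" "\<And>z. f z = (\<Prod>a\<in>Z. z - a) * g z"
    using entire_divide_zeros[OF assms(1-3)] by blast
  have le: "cmod (g w) \<le> B / (6 * r) ^ card Z"
  proof (rule maximum_modulus_frontier[where S = "ball 0 (7 * r)" and f = g and \<xi> = w])
    show "g holomorphic_on interior (ball 0 (7 * r))" "continuous_on (closure (ball 0 (7 * r))) g"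
      using g(1) holomorphic_on_imp_continuous_on
      by (auto intro: holomorphic_on_subset continuous_on_subset)
    show "w \<in> ball 0 (7 * r)" using r(1,3) by simp
  next
    fix z assume "z \<in> frontier (ball (0::complex) (7 * r))"
    then have z: "cmod z = 7 * r" using r(1) by (simp add: frontier_ball)
    have "(6 * r) ^ card Z * cmod (g z) = (\<Prod>a\<in>Z. 6 * r) * cmod (g z)" by simp
    also have "\<dots> \<le> (\<Prod>a\<in>Z. cmod (z - a)) * cmod (g z)"
    proof (intro mult_right_mono prod_mono conjI)
      fix a assume "a \<in> Z"
      then show "6 * r \<le> cmod (z - a)"
        using r(2)[of a] z norm_triangle_ineq2[of z a] by linarith
    qed (use r in auto)
    also have "\<dots> = cmod (f z)" by (simp add: g(2) norm_mult prod_norm)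
    also have "\<dots> \<le> B" by (rule B[OF z])
    finally show "cmod (g z) \<le> B / (6 * r) ^ card Z" using r(1) by (simp add: field_simps)
  qed auto
  have "cmod (f w) = (\<Prod>a\<in>Z. cmod (w - a)) * cmod (g w)" by (simp add: g(2) norm_mult prod_norm)
  also have "\<dots> \<le> (\<Prod>a\<in>Z. 2 * r) * cmod (g w)"
  proof (intro mult_right_mono prod_mono conjI)
    fix a assume "a \<in> Z"
    then show "cmod (w - a) \<le> 2 * r"
      using r(2)[of a] r(3) norm_triangle_ineq4[of w a] by linarith
  qed auto
  also have "\<dots> \<le> (2 * r) ^ card Z * (B / (6 * r) ^ card Z)"
    using mult_left_mono[OF le, of "(2 * r) ^ card Z"] r(1) by simp
  finally have "3 ^ card Z * cmod (f w) \<le> 3 ^ card Z * ((2 * r) ^ card Z * (B / (6 * r) ^ card Z))"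
    by (rule mult_left_mono) simp
  moreover have "(6 * r) ^ card Z = 3 ^ card Z * (2 * r) ^ card Z"
    using power_mult_distrib[of 3 "2 * r" "card Z"] by (simp only: mult.assoc[symmetric]) simp
  ultimately show ?thesis using r(1) by simp
qed

section \<open>Sizes of elements of an order\<close>

text \<open>The vector \<open>v\<close> satisfies the eigenvector equation of the integer matrix
  \<open>M\<close> for \<open>g\<close>, which is how the bound on nonzero eigenvalues reaches
  \<open>g\<close>.\<close>

definition acts_as :: "nat \<Rightarrow> (nat \<Rightarrow> complex) \<Rightarrow> (nat \<Rightarrow> nat \<Rightarrow> int) \<Rightarrow> complex \<Rightarrow> bool" where
  "acts_as D v M g \<longleftrightarrow> (\<forall>i<D. (\<Sum>j<D. of_int (M i j) * v j) = g * v i)"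

text \<open>The maximal row sum is a submultiplicative matrix norm, so these bounds add and multiply
  along with the numbers.\<close>

definition rows_le :: "nat \<Rightarrow> (nat \<Rightarrow> nat \<Rightarrow> int) \<Rightarrow> int \<Rightarrow> bool" where
  "rows_le D M B \<longleftrightarrow> (\<forall>i<D. (\<Sum>j<D. \<bar>M i j\<bar>) \<le> B)"

text \<open>A substitute for the height of an element of an order with \<open>\<int>\<close>-generators
  \<open>v 0, \<dots>, v (D - 1)\<close>: a bound on an integer matrix of multiplication by \<open>g\<close>.\<close>
definition size_le :: "nat \<Rightarrow> (nat \<Rightarrow> complex) \<Rightarrow> complex \<Rightarrow> int \<Rightarrow> bool" where
  "size_le D v g B \<longleftrightarrow> (\<exists>M. acts_as D v M g \<and> rows_le D M B)"

lemma size_le_mono: "size_le D v g B \<Longrightarrow> B \<le> B' \<Longrightarrow> size_le D v g B'"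
  unfolding size_le_def rows_le_def by (meson order_trans)

text \<open>Together with \<open>acts_as_zero_matrix\<close> this turns the vanishing of a
  combination of algebraic numbers into integer linear equations in the weights \<open>x u\<close>,
  one for each matrix entry.\<close>

lemma acts_as_sum:
  assumes "\<And>u. u \<in> U \<Longrightarrow> acts_as D v (M u) (g u)"
  shows "acts_as D v (\<lambda>i j. \<Sum>u\<in>U. M u i j * x u) (\<Sum>u\<in>U. g u * of_int (x u))"
  unfolding acts_as_def
proof (intro allI impI)
  fix i assume i: "i < D"
  have "(\<Sum>j<D. of_int (\<Sum>u\<in>U. M u i j * x u) * v j)
    = (\<Sum>j<D. \<Sum>u\<in>U. of_int (x u) * (of_int (M u i j) * v j))"
    by (simp add: sum_distrib_left sum_distrib_right mult_ac)
  also have "\<dots> = (\<Sum>u\<in>U. \<Sum>j<D. of_int (x u) * (of_int (M u i j) * v j))"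
    by (rule sum.swap)
  also have "\<dots> = (\<Sum>u\<in>U. of_int (x u) * (g u * v i))"
    using assms i by (simp add: acts_as_def flip: sum_distrib_left)
  also have "\<dots> = (\<Sum>u\<in>U. g u * of_int (x u)) * v i"
    by (simp add: sum_distrib_left mult_ac)
  finally show "(\<Sum>j<D. of_int (\<Sum>u\<in>U. M u i j * x u) * v j) = (\<Sum>u\<in>U. g u * of_int (x u)) * v i" .
qed

lemma acts_as_zero_matrix:
  assumes "acts_as D v M g" "\<And>i j. i < D \<Longrightarrow> j < D \<Longrightarrow> M i j = 0" "i < D" "v i \<noteq> 0"
  shows "g = 0"
  using assms(1)[unfolded acts_as_def, rule_format, OF assms(3)] assms by simp

lemma rows_le_entry:
  assumes "rows_le D M B" "i < D" "j < D"
  shows "\<bar>M i j\<bar> \<le> B"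
proof -
  have "\<bar>M i j\<bar> \<le> (\<Sum>j<D. \<bar>M i j\<bar>)" using assms(3) by (intro member_le_sum) auto
  then show ?thesis using assms unfolding rows_le_def by force
qed

lemma size_le_sum:
  assumes "\<And>u. u \<in> U \<Longrightarrow> size_le D v (g u) (B u)"
  shows "size_le D v (\<Sum>u\<in>U. g u) (\<Sum>u\<in>U. B u)"
proof -
  obtain M where M: "\<And>u. u \<in> U \<Longrightarrow> acts_as D v (M u) (g u) \<and> rows_le D (M u) (B u)"
    using assms unfolding size_le_def by metis
  have "acts_as D v (\<lambda>i j. \<Sum>u\<in>U. M u i j * 1) (\<Sum>u\<in>U. g u * of_int 1)"
    using M by (intro acts_as_sum) auto
  moreover have "rows_le D (\<lambda>i j. \<Sum>u\<in>U. M u i j) (\<Sum>u\<in>U. B u)"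
    unfolding rows_le_def
  proof (intro allI impI)
    fix i assume i: "i < D"
    have "(\<Sum>j<D. \<bar>\<Sum>u\<in>U. M u i j\<bar>) \<le> (\<Sum>j<D. \<Sum>u\<in>U. \<bar>M u i j\<bar>)"
      by (intro sum_mono sum_abs)
    also have "\<dots> = (\<Sum>u\<in>U. \<Sum>j<D. \<bar>M u i j\<bar>)" by (rule sum.swap)
    also have "\<dots> \<le> (\<Sum>u\<in>U. B u)" using M i by (intro sum_mono) (auto simp: rows_le_def)
    finally show "(\<Sum>j<D. \<bar>\<Sum>u\<in>U. M u i j\<bar>) \<le> (\<Sum>u\<in>U. B u)" .
  qed
  ultimately show ?thesis unfolding size_le_def by auto
qed

lemma size_le_mult:
  assumes g: "size_le D v g B" and h: "size_le D v h B'" and B': "0 \<le> B'"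
  shows "size_le D v (g * h) (B * B')"
proof -
  obtain M where M: "acts_as D v M g" "rows_le D M B" using g by (auto simp: size_le_def)
  obtain N where N: "acts_as D v N h" "rows_le D N B'" using h by (auto simp: size_le_def)
  define P where "P = (\<lambda>i j. \<Sum>k<D. M i k * N k j)"
  have "acts_as D v P (g * h)"
    unfolding acts_as_def
  proof (intro allI impI)
    fix i assume i: "i < D"
    have "(\<Sum>j<D. of_int (P i j) * v j) = (\<Sum>j<D. \<Sum>k<D. of_int (M i k) * (of_int (N k j) * v j))"
      by (simp add: P_def sum_distrib_right mult.assoc)
    also have "\<dots> = (\<Sum>k<D. \<Sum>j<D. of_int (M i k) * (of_int (N k j) * v j))" by (rule sum.swap)
    also have "\<dots> = (\<Sum>k<D. of_int (M i k) * (h * v k))"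
      using N(1) by (simp add: acts_as_def flip: sum_distrib_left)
    also have "\<dots> = h * (\<Sum>k<D. of_int (M i k) * v k)"
      by (simp add: sum_distrib_left mult.left_commute)
    finally show "(\<Sum>j<D. of_int (P i j) * v j) = g * h * v i"
      using M(1) i by (simp add: acts_as_def)
  qed
  moreover have "rows_le D P (B * B')"
    unfolding rows_le_def
  proof (intro allI impI)
    fix i assume i: "i < D"
    have "(\<Sum>j<D. \<bar>P i j\<bar>) \<le> (\<Sum>j<D. \<Sum>k<D. \<bar>M i k\<bar> * \<bar>N k j\<bar>)"
      unfolding P_def by (intro sum_mono order.trans[OF sum_abs]) (simp add: abs_mult)
    also have "\<dots> = (\<Sum>k<D. \<Sum>j<D. \<bar>M i k\<bar> * \<bar>N k j\<bar>)" by (rule sum.swap)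
    also have "\<dots> = (\<Sum>k<D. \<bar>M i k\<bar> * (\<Sum>j<D. \<bar>N k j\<bar>))" by (simp add: sum_distrib_left)
    also have "\<dots> \<le> (\<Sum>k<D. \<bar>M i k\<bar> * B')"
      using N(2) by (intro sum_mono mult_left_mono) (auto simp: rows_le_def)
    also have "\<dots> = (\<Sum>k<D. \<bar>M i k\<bar>) * B'" by (simp add: sum_distrib_right)
    also have "\<dots> \<le> B * B'" using M(2) i B' by (intro mult_right_mono) (auto simp: rows_le_def)
    finally show "(\<Sum>j<D. \<bar>P i j\<bar>) \<le> B * B'" .
  qed
  ultimately show ?thesis unfolding size_le_def by blast
qed

lemma size_le_of_int: "size_le D v (of_int n) \<bar>n\<bar>"
  unfolding size_le_def acts_as_def rows_le_def
  by (rule exI[of _ "\<lambda>i j. if j = i then n else 0"]) (auto simp: if_distrib if_distribR cong: if_cong)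

lemma size_le_add: "size_le D v g B \<Longrightarrow> size_le D v h B' \<Longrightarrow> size_le D v (g + h) (B + B')"
  using size_le_sum[of "{True, False}" D v "\<lambda>b. if b then g else h" "\<lambda>b. if b then B else B'"]
  by auto

lemma size_le_power: "size_le D v g B \<Longrightarrow> 0 \<le> B \<Longrightarrow> size_le D v (g ^ n) (B ^ n)"
  using size_le_of_int[of D v 1] by (induction n) (auto intro!: size_le_mult)

text \<open>The Liouville inequality: \<open>g\<close> is a nonzero eigenvalue of an integer matrix
  with row sums at most \<open>B\<close>.\<close>

lemma size_le_lower_bound:
  assumes g: "size_le D v g B" "g \<noteq> 0" and B: "1 \<le> B" and i: "i < D" "v i \<noteq> 0"
  shows "1 \<le> cmod g * real_of_int B ^ D"
proof -
  obtain M where M: "acts_as D v M g" "rows_le D M B" using g by (auto simp: size_le_def)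
  define N where "N = mat D D (\<lambda>(i,j). M i j)"
  show ?thesis
  proof (rule integer_matrix_eigenvalue_lower_bound[of N])
    show "N \<in> carrier_mat D D" by (simp add: N_def)
    have "map_mat of_int N *\<^sub>v vec D v = g \<cdot>\<^sub>v vec D v"
      using M(1) by (intro eq_vecI) (auto simp: N_def acts_as_def scalar_prod_def atLeast0LessThan)
    moreover have "vec D v \<noteq> 0\<^sub>v D" using i by (metis index_vec index_zero_vec(1))
    ultimately show "eigenvalue (map_mat of_int N) g"
      unfolding eigenvalue_def eigenvector_def by (intro exI[of _ "vec D v"]) (simp add: N_def)
    fix i assume "i < D"
    then show "(\<Sum>j<D. real_of_int \<bar>N $$ (i,j)\<bar>) \<le> real_of_int B"
      using M(2) unfolding rows_le_def N_def by (simp flip: of_int_abs of_int_sum)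
  qed (use assms in auto)
qed

lemma sum_lessThan_double: "(\<Sum>j<2 * d. f j) = (\<Sum>b<d. f (2 * b) + f (2 * b + 1 :: nat) :: 'a::comm_monoid_add)"
  by (induction d) (auto simp: algebra_simps)

text \<open>The coefficients form the matrix of multiplication by sqrt(2) on a basis that alternates
  between an element and sqrt(2) times it. The function \<open>f\<close> is left general so that one
  computation covers both the action on the basis and the row sums.\<close>

lemma sum_sqrt2_row:
  fixes f :: "int \<Rightarrow> nat \<Rightarrow> 'z::comm_monoid_add"
  assumes "i < 2 * d" "\<And>j. f 0 j = 0"
  shows "(\<Sum>j<2 * d. f (if even i then of_bool (j = i + 1) else if j + 1 = i then 2 else 0) j)
    = (if even i then f 1 (i + 1) else f 2 (i - 1))"
proof (cases "even i")
  case True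
  then have "i + 1 < 2 * d" using assms(1) by (auto elim!: evenE)
  moreover have "(\<Sum>j<2 * d. f (of_bool (j = i + 1)) j) = (\<Sum>j<2 * d. if j = i + 1 then f 1 j else 0)"
    using assms(2) by (intro sum.cong) auto
  ultimately show ?thesis using True by simp
next
  case False
  then have i: "i \<ge> 1" by (cases i) auto
  have "(\<Sum>j<2 * d. f (if j + 1 = i then 2 else 0) j) = (\<Sum>j<2 * d. if j = i - 1 then f 2 j else 0)"
    using assms(2) i by (intro sum.cong) auto
  moreover have "i - 1 < 2 * d" using assms(1) by simp
  ultimately show ?thesis using False by simp
qed

text \<open>The order \<open>\<int>[\<surd>2, q s]\<close>, where \<open>q\<close> is the leading coefficient of an integer
  polynomial of degree \<open>d\<close> with root \<open>s\<close>, is generated by \<open>\<surd>2 ^ a * (q s) ^ b\<close> for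
  \<open>a < 2\<close> and \<open>b < d\<close>.\<close>
lemma algebraic_order:
  assumes "algebraic (s :: complex)"
  obtains D v q C where "0 < D" "v 0 \<noteq> 0" "q \<noteq> 0" "\<bar>q\<bar> \<le> C"
    "size_le D v (of_real (sqrt 2)) 2" "size_le D v (of_int q * s) C"
proof -
  obtain p where p: "\<And>i. coeff p i \<in> \<int>" "p \<noteq> 0" "poly p s = 0"
    using algebraicE[OF assms] by blast
  have "\<forall>i. \<exists>z. coeff p i = of_int z" using p(1) by (meson Ints_cases)
  then obtain c where c: "\<And>i. coeff p i = of_int (c i)" by metis
  define d where "d = degree p"
  define q where "q = c d"
  have q: "q \<noteq> 0" using p(2) c[of d] by (auto simp: q_def d_def)
  have d: "0 < d"
  proof (rule ccontr)
    assume "\<not> 0 < d"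
    then obtain a where "p = [:a:]" by (metis d_def degree_eq_zeroE neq0_conv)
    then show False using p by auto
  qed
  define \<eta> where "\<eta> = of_int q * s"
  \<comment> \<open>Multiplying the equation of \<open>s\<close> by \<open>q ^ (d - 1)\<close> gives
    a monic integer equation for \<open>\<eta>\<close>; these are its lower coefficients, moved to
    the other side.\<close>
  define e where "e = (\<lambda>b. - c b * q ^ (d - 1 - b))"
  have eta_d: "\<eta> ^ d = (\<Sum>b<d. of_int (e b) * \<eta> ^ b)"
  proof -
    have "0 = (\<Sum>i\<le>d. of_int (c i) * s ^ i)" using p(3) by (simp add: poly_altdef d_def c)
    also have "\<dots> = (\<Sum>i<d. of_int (c i) * s ^ i) + of_int q * s ^ d"
      by (simp add: q_def flip: lessThan_Suc_atMost)
    finally have *: "of_int q * s ^ d = - (\<Sum>i<d. of_int (c i) * s ^ i)" by (simp add: eq_neg_iff_add_eq_0 add.commute)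
    have "\<eta> ^ d = of_int q ^ (d - 1) * (of_int q * s ^ d)"
      using power_minus_mult[OF d, of "of_int q :: complex"] by (simp add: \<eta>_def power_mult_distrib)
    also have "\<dots> = (\<Sum>i<d. - (of_int q ^ (d - 1) * (of_int (c i) * s ^ i)))"
      by (simp add: * sum_distrib_left sum_negf)
    also have "\<dots> = (\<Sum>b<d. of_int (e b) * \<eta> ^ b)"
    proof (rule sum.cong)
      fix i assume i: "i \<in> {..<d}"
      then have "of_int q ^ (d - 1) = (of_int q :: complex) ^ (d - 1 - i) * of_int q ^ i"
        by (simp flip: power_add)
      then show "- (of_int q ^ (d - 1) * (of_int (c i) * s ^ i)) = of_int (e i) * \<eta> ^ i"
        by (simp add: e_def \<eta>_def power_mult_distrib)
    qed auto
    finally show ?thesis .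
  qed
  define w :: complex where "w = of_real (sqrt 2)"
  have w: "w * w = 2" by (simp add: w_def flip: of_real_mult)
  define v where "v = (\<lambda>i. w ^ (i mod 2) * \<eta> ^ (i div 2))"
  \<comment> \<open>Two interleaved companion matrices, one for each parity of the index: raising
    the exponent of \<open>\<eta>\<close> moves the index by 2, and the last two rows use the monic
    equation.\<close>
  define M where "M = (\<lambda>i j. if i + 2 < 2 * d then of_bool (j = i + 2)
    else if j mod 2 = i mod 2 then e (j div 2) else 0)"
  have "acts_as (2 * d) v M \<eta>"
    unfolding acts_as_def
  proof (intro allI impI)
    fix i assume i: "i < 2 * d"
    show "(\<Sum>j<2 * d. of_int (M i j) * v j) = \<eta> * v i"
    proof (cases "i + 2 < 2 * d")
      case True
      then have "(\<Sum>j<2 * d. of_int (M i j) * v j) = (\<Sum>j<2 * d. if j = i + 2 then v j else 0)"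
        by (intro sum.cong) (auto simp: M_def)
      then show ?thesis using True by (simp add: v_def)
    next
      case False
      define a where "a = i mod 2"
      have a: "a < 2" "i div 2 = d - 1" using False i by (auto simp: a_def)
      have "(\<Sum>j<2 * d. of_int (M i j) * v j) = (\<Sum>b<d. of_int (e b) * (w ^ a * \<eta> ^ b))"
        unfolding sum_lessThan_double
      proof (rule sum.cong)
        fix b assume "b \<in> {..<d}"
        show "of_int (M i (2 * b)) * v (2 * b) + of_int (M i (2 * b + 1)) * v (2 * b + 1)
          = of_int (e b) * (w ^ a * \<eta> ^ b)"
          using False a(1) by (cases "a = 0") (auto simp: M_def v_def a_def)
      qed auto
      also have "\<dots> = w ^ a * \<eta> ^ d" by (simp add: eta_d sum_distrib_left mult.left_commute)
      also have "\<dots> = \<eta> * v i" using d a power_minus_mult[of d \<eta>] by (simp add: v_def a_def mult_ac)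
      finally show ?thesis .
    qed
  qed
  \<comment> \<open>A crude constant that dominates every row sum of \<open>M\<close> and also
    \<open>\<bar>q\<bar>\<close>.\<close>
  moreover define C where "C = \<bar>q\<bar> + (\<Sum>i<2 * d. \<Sum>j<2 * d. \<bar>M i j\<bar>)"
  have "rows_le (2 * d) M C"
    unfolding rows_le_def
  proof (intro allI impI)
    fix i assume i: "i < 2 * d"
    have "(\<Sum>j<2 * d. \<bar>M i j\<bar>) \<le> (\<Sum>i<2 * d. \<Sum>j<2 * d. \<bar>M i j\<bar>)"
      using i by (intro member_le_sum) (auto intro: sum_nonneg)
    then show "(\<Sum>j<2 * d. \<bar>M i j\<bar>) \<le> C" by (simp add: C_def)
  qed
  ultimately have eta: "size_le (2 * d) v \<eta> C" unfolding size_le_def by blast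
  define N where "N = (\<lambda>i j :: nat. if even i then of_bool (j = i + 1) else if j + 1 = i then 2 else 0 :: int)"
  have "acts_as (2 * d) v N w"
    unfolding acts_as_def
  proof (intro allI impI)
    fix i assume i: "i < 2 * d"
    have "(\<Sum>j<2 * d. of_int (N i j) * v j) = (if even i then v (i + 1) else 2 * v (i - 1))"
      using sum_sqrt2_row[OF i, of "\<lambda>x j. of_int x * v j"] by (simp add: N_def)
    also have "\<dots> = w * v i"
    proof (cases "even i")
      case True
      then obtain b where "i = 2 * b" by (elim evenE)
      then show ?thesis by (simp add: v_def)
    next
      case False
      then obtain b where "i = 2 * b + 1" by (elim oddE)
      then show ?thesis using w by (simp add: v_def mult.assoc[symmetric])
    qed
    finally show "(\<Sum>j<2 * d. of_int (N i j) * v j) = w * v i" .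
  qed
  moreover have "rows_le (2 * d) N 2"
    unfolding rows_le_def using sum_sqrt2_row[of _ d "\<lambda>x j. \<bar>x\<bar>"] by (auto simp: N_def)
  ultimately have "size_le (2 * d) v w 2" unfolding size_le_def by blast
  moreover have "\<bar>q\<bar> \<le> C" by (simp add: C_def sum_nonneg)
  ultimately show ?thesis
    using d q eta that[of "2 * d" v q C] by (simp add: v_def w_def \<eta>_def)
qed

section \<open>Exponential polynomials\<close>

definition tau :: complex where
  "tau = exp (of_real pi * \<i> * of_real (sqrt 2))"

definition node :: "nat \<Rightarrow> nat \<Rightarrow> complex" where
  "node n m = of_nat n + of_nat m * of_real (sqrt 2)"

definition expmon :: "nat \<times> nat \<Rightarrow> complex \<Rightarrow> complex" where
  "expmon u z = z ^ fst u * exp (of_real pi * \<i> * of_nat (snd u) * z)"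

definition expoly :: "(nat \<times> nat \<Rightarrow> int) \<Rightarrow> (nat \<times> nat) set \<Rightarrow> complex \<Rightarrow> complex" where
  "expoly a U z = (\<Sum>u\<in>U. of_int (a u) * expmon u z)"

lemma sqrt2_irrational: "sqrt 2 \<notin> \<rat>"
proof
  assume "sqrt 2 \<in> \<rat>"
  then obtain m n :: nat where n: "n \<noteq> 0" and eq: "\<bar>sqrt 2\<bar> = real m / real n" and co: "coprime m n"
    by (rule Rats_abs_nat_div_natE)
  have "real m = sqrt 2 * real n" using n eq by simp
  then have "real (m ^ 2) = real (2 * n ^ 2)" by (simp add: power_mult_distrib)
  then have *: "m ^ 2 = 2 * n ^ 2" by (rule of_nat_eq_iff[THEN iffD1])
  then have "even m" by (metis dvd_triv_left even_power)
  then obtain k where "m = 2 * k" by (elim evenE)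
  with * have "n ^ 2 = 2 * k ^ 2" by (simp add: power_mult_distrib)
  then have "even n" by (metis dvd_triv_left even_power)
  with \<open>even m\<close> show False using co by (meson coprime_common_divisor_nat not_is_unit_0 odd_one coprime_def)
qed

text \<open>By irrationality of sqrt(2). This makes an \<open>M\<close> by \<open>M\<close> grid of
  nodes supply \<open>M ^ 2\<close> distinct zeros.\<close>

lemma node_inject [simp]: "node n m = node n' m' \<longleftrightarrow> n = n' \<and> m = m'"
proof
  assume "node n m = node n' m'"
  then have "complex_of_real (real n + real m * sqrt 2) = of_real (real n' + real m' * sqrt 2)"
    by (simp add: node_def)
  then have eq: "real n + real m * sqrt 2 = real n' + real m' * sqrt 2" by (rule of_real_eq_iff[THEN iffD1])
  have "m = m'"
  proof (rule ccontr)
    assume "m \<noteq> m'"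
    then have "sqrt 2 = (real n' - real n) / (real m - real m')" using eq by (simp add: field_simps)
    then show False using sqrt2_irrational by (metis Rats_diff Rats_divide Rats_of_nat)
  qed
  then show "n = n' \<and> m = m'" using eq by simp
qed auto

text \<open>A coincidence of powers would make \<open>(m - m') * sqrt 2\<close> an even
  integer.\<close>

lemma inj_tau_power: "inj (\<lambda>m. tau ^ m)"
proof (rule injI)
  fix m m' :: nat assume "tau ^ m = tau ^ m'"
  then have "exp (of_nat m * (of_real pi * \<i> * of_real (sqrt 2)))
    = exp (of_nat m' * (of_real pi * \<i> * of_real (sqrt 2)) :: complex)"
    by (simp add: tau_def exp_of_nat_mult)
  then obtain n :: int where "of_nat m * (of_real pi * \<i> * of_real (sqrt 2))
    = of_nat m' * (of_real pi * \<i> * of_real (sqrt 2)) + (of_int (2 * n) * pi) * \<i>"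
    by (auto simp: exp_eq)
  then have "Im (of_nat m * (of_real pi * \<i> * of_real (sqrt 2)))
    = Im (of_nat m' * (of_real pi * \<i> * of_real (sqrt 2)) + (of_int (2 * n) * pi) * \<i>)" by simp
  then have "pi * (real m * sqrt 2) = pi * (real m' * sqrt 2 + 2 * of_int n)"
    by (simp add: algebra_simps)
  then have eq: "real m * sqrt 2 = real m' * sqrt 2 + 2 * of_int n" by simp
  show "m = m'"
  proof (rule ccontr)
    assume "m \<noteq> m'"
    then have "sqrt 2 = of_int (2 * n) / (real m - real m')" using eq by (simp add: field_simps)
    then show False using sqrt2_irrational by (metis Rats_diff Rats_divide Rats_of_nat Rats_of_int)
  qed
qed

text \<open>At a node \<open>exp (\<i> \<pi> z)\<close> is a power of \<open>tau\<close> up to sign.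
  If \<open>tau\<close> were algebraic, all these values would therefore lie in one number
  field.\<close>

lemma expmon_node: "expmon (k, l) (node n m) = node n m ^ k * ((-1) ^ (l * n) * tau ^ (l * m))"
proof -
  have "of_real pi * \<i> * of_nat l * node n m
    = of_nat (l * n) * (of_real pi * \<i>) + of_nat (l * m) * (of_real pi * \<i> * of_real (sqrt 2))"
    by (simp add: node_def algebra_simps)
  then have "exp (of_real pi * \<i> * of_nat l * node n m) = (-1) ^ (l * n) * tau ^ (l * m)"
    by (simp only: exp_add exp_of_nat_mult exp_pi_i tau_def)
  then show ?thesis by (simp add: expmon_def)
qed

lemma cmod_node_le: "n \<le> M \<Longrightarrow> m \<le> M \<Longrightarrow> cmod (node n m) \<le> 3 * real M"
proof -
  assume le: "n \<le> M" "m \<le> M"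
  have "cmod (node n m) \<le> real n + real m * sqrt 2"
    unfolding node_def by (rule order.trans[OF norm_triangle_ineq]) (simp add: norm_mult)
  also have "\<dots> \<le> real M + real M * 2"
    using le sqrt2_less_2 by (intro add_mono mult_mono) auto
  finally show ?thesis by simp
qed

lemma poly_zero_of_inj:
  fixes p :: "complex poly"
  assumes "inj f" "\<And>n :: nat. poly p (f n) = 0"
  shows "p = 0"
proof (rule ccontr)
  assume "p \<noteq> 0"
  then have "finite {x. poly p x = 0}" by (rule poly_roots_finite)
  moreover have "range f \<subseteq> {x. poly p x = 0}" using assms(2) by auto
  ultimately show False using assms(1) finite_subset range_inj_infinite by blast
qed

text \<open>Fix \<open>m\<close>: along suitable \<open>n\<close> the function becomes a polynomial
  in the node with infinitely many zeros. Each of its coefficients is in turn a polynomial in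
  \<open>tau ^ m\<close> that vanishes for all \<open>m\<close>.\<close>

lemma expoly_all_nodes_zero:
  assumes zero: "\<And>n m. expoly a ({..<K} \<times> {..<L}) (node n m) = 0" and kl: "k < K" "l < L"
  shows "a (k, l) = 0"
proof -
  have *: "(\<Sum>l<L. of_int (a (k, l)) * tau ^ (l * m)) = 0" for m
  proof -
    define c where "c = (\<lambda>k. \<Sum>l<L. of_int (a (k, l)) * tau ^ (l * m))"
    define p where "p = (\<Sum>k<K. monom (c k) k)"
    have "p = 0"
    \<comment> \<open>Even first indices remove the sign \<open>(-1) ^ (l * n)\<close>, which would
      otherwise make the coefficients depend on \<open>n\<close>.\<close>
    proof (rule poly_zero_of_inj[of "\<lambda>n. node (n * 2) m"])
      show "inj (\<lambda>n. node (n * 2) m)" by (auto intro: injI)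
    next
      fix n
      have expmon_node': "expmon (k, l) (node (n * 2) m) = node (n * 2) m ^ k * tau ^ (l * m)" for k l
        by (simp add: expmon_node)
      have "poly p (node (n * 2) m) = expoly a ({..<K} \<times> {..<L}) (node (n * 2) m)"
        by (simp add: p_def poly_sum poly_monom expoly_def sum.cartesian_product' case_prod_unfold
            expmon_node' c_def sum_distrib_left sum_distrib_right mult_ac)
      then show "poly p (node (n * 2) m) = 0" using zero by simp
    qed
    then have "coeff p k = 0" by simp
    then show ?thesis using kl by (simp add: p_def coeff_sum c_def)
  qed
  define p where "p = (\<Sum>l<L. monom (complex_of_int (a (k, l))) l)"
  have "p = 0"
    by (rule poly_zero_of_inj[OF inj_tau_power])
       (use * in \<open>simp add: p_def poly_sum poly_monom mult.commute flip: power_mult\<close>)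
  then have "coeff p l = 0" by simp
  then show ?thesis using kl by (simp add: p_def coeff_sum)
qed

lemma expoly_holomorphic: "expoly a U holomorphic_on S"
  unfolding expoly_def expmon_def by (intro holomorphic_intros)

lemma expmon_bound:
  assumes "k < K" "l < L" "cmod z = R" "1 \<le> R"
  shows "cmod (expmon (k, l) z) \<le> R ^ K * exp (pi * L * R)"
proof -
  have "cmod (expmon (k, l) z) = R ^ k * exp (Re (of_real pi * \<i> * of_nat l * z))"
    using assms by (simp add: expmon_def norm_mult norm_power)
  also have "\<dots> \<le> R ^ K * exp (pi * L * R)"
  proof (intro mult_mono)
    have "Re (of_real pi * \<i> * of_nat l * z) \<le> cmod (of_real pi * \<i> * of_nat l * z)"
      by (rule complex_Re_le_cmod)
    also have "\<dots> = pi * l * R" using assms by (simp add: norm_mult)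
    also have "\<dots> \<le> pi * L * R" using assms by (intro mult_mono) auto
    finally show "exp (Re (of_real pi * \<i> * of_nat l * z)) \<le> exp (pi * L * R)" by simp
  qed (use assms in \<open>auto intro!: power_increasing\<close>)
  finally show ?thesis .
qed

lemma expoly_bound:
  assumes a: "\<And>u. u \<in> {..<K} \<times> {..<L} \<Longrightarrow> \<bar>a u\<bar> \<le> X" and z: "cmod z = R" "1 \<le> R"
  shows "cmod (expoly a ({..<K} \<times> {..<L}) z) \<le> real (K * L) * X * (R ^ K * exp (pi * L * R))"
proof -
  have "cmod (expoly a ({..<K} \<times> {..<L}) z) \<le> (\<Sum>u\<in>{..<K} \<times> {..<L}. cmod (of_int (a u) * expmon u z))"
    unfolding expoly_def by (rule norm_sum)
  also have "\<dots> \<le> (\<Sum>u\<in>{..<K} \<times> {..<L}. X * (R ^ K * exp (pi * L * R)))"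
  proof (intro sum_mono)
    fix u assume u: "u \<in> {..<K} \<times> {..<L}"
    then obtain k l where kl: "u = (k, l)" "k < K" "l < L" by auto
    have "real_of_int \<bar>a u\<bar> \<le> X" using a[OF u] by linarith
    then show "cmod (of_int (a u) * expmon u z) \<le> X * (R ^ K * exp (pi * L * R))"
      using expmon_bound[OF kl(2,3) z] unfolding norm_mult norm_of_int kl(1)[symmetric]
      by (intro mult_mono) auto
  qed
  also have "\<dots> = real (K * L) * X * (R ^ K * exp (pi * L * R))" by simp
  finally show ?thesis .
qed

section \<open>Schneider's method\<close>

text \<open>Here \<open>x\<close> stands for the grid side \<open>M\<close>. The left side has order
  \<open>x * sqrt x * ln x\<close>, below the quadratic gain from \<open>M ^ 2\<close>
  zeros.\<close>

lemma schneider_growth: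
  fixes D c :: real
  assumes "D \<ge> 1" "c \<ge> 1"
  shows "eventually (\<lambda>x. (D + 1) * (ln 2 + 2 * ln (2 * D\<^sup>2 * x\<^sup>2) + 4 * D\<^sup>2 * (x * sqrt x) * ln (21 * x)
    + 2 * (x * sqrt x) * ln c) < x\<^sup>2 * ln 3) at_top"
proof -
  define c' where "c' = ln c"
  have "D > 0" using assms by simp
  then show ?thesis unfolding c'_def[symmetric] by real_asymp
qed

text \<open>Take logarithms. From \<open>T ^ 2 \<le> M\<close> both \<open>K\<close> and
  \<open>T * M\<close> are of order at most \<open>M * sqrt M\<close>, and \<open>K * T\<close>
  enters only through its logarithm, so \<open>schneider_growth\<close> applies. A single
  \<open>T\<close> must serve all larger \<open>M\<close>, since the zeros are propagated with fixed
  coefficients.\<close>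

lemma schneider_parameters:
  fixes C :: real and D :: nat
  assumes "D \<ge> 1" "C \<ge> 1"
  obtains T :: nat where "T \<ge> 1" "\<And>M K. M \<ge> T ^ 2 \<Longrightarrow> K = 2 * D ^ 2 * T ^ 3 \<Longrightarrow>
    (2 * real (K * T) ^ 2 * (21 * real M) ^ (2 * K) * (C * exp 66) ^ (2 * T * M)) ^ (D + 1) < 3 ^ (M ^ 2)"
proof -
  define c where "c = C * exp 66"
  have c: "c \<ge> 1" unfolding c_def using assms mult_mono[of 1 C 1 "exp 66"] by simp
  obtain x0 where x0: "\<And>x::real. x \<ge> x0 \<Longrightarrow> (real D + 1) * (ln 2 + 2 * ln (2 * (real D)\<^sup>2 * x\<^sup>2)
      + 4 * (real D)\<^sup>2 * (x * sqrt x) * ln (21 * x) + 2 * (x * sqrt x) * ln c) < x\<^sup>2 * ln 3"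
    using schneider_growth[of "real D" c] assms(1) c by (auto simp: eventually_at_top_linorder)
  \<comment> \<open>Then \<open>M \<ge> T ^ 2 \<ge> T \<ge> x0\<close>, which puts every admissible
    \<open>M\<close> in the asymptotic range.\<close>
  define T where "T = max 1 (nat \<lceil>x0\<rceil>)"
  have T: "T \<ge> 1" "real T \<ge> x0" by (auto simp: T_def) linarith
  show ?thesis
  proof (rule that[OF T(1)])
    fix M K assume M: "M \<ge> T ^ 2" and K: "K = 2 * D ^ 2 * T ^ 3"
    have TM: "real T ^ 2 \<le> real M" using M by (simp flip: of_nat_power)
    have "real T \<le> real T ^ 2" using T(1) by (simp add: power2_eq_square)
    then have Mx: "real M \<ge> x0" "real M \<ge> 1" using TM T by linarith+
    have Ts: "real T \<le> sqrt M" using TM by (rule real_le_rsqrt)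
    have T3: "real T ^ 3 \<le> M * sqrt M"
      using mult_mono[OF TM Ts] by (simp add: power3_eq_cube power2_eq_square)
    have TMs: "real T * M \<le> M * sqrt M" using mult_right_mono[OF Ts, of M] by (simp add: mult.commute)
    have K': "real K \<le> 2 * (real D)\<^sup>2 * (M * sqrt M)"
      unfolding K using T3 by (simp add: mult_left_mono)
    have KT: "real (K * T) \<le> 2 * (real D)\<^sup>2 * (real M)\<^sup>2"
    proof -
      have "real (K * T) = 2 * (real D)\<^sup>2 * (real T ^ 2) ^ 2"
        by (simp add: K power_numeral_reduce)
      also have "\<dots> \<le> 2 * (real D)\<^sup>2 * (real M)\<^sup>2"
        using TM by (intro mult_left_mono power_mono) auto
      finally show ?thesis .
    qed
    have KT1: "real (K * T) \<ge> 1"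
      using T(1) assms(1) by (simp add: K Suc_leI flip: of_nat_mult of_nat_power)
    define Y where "Y = 2 * real (K * T) ^ 2 * (21 * real M) ^ (2 * K) * c ^ (2 * T * M)"
    have Y: "Y > 0" unfolding Y_def using KT1 Mx(2) c by (intro mult_pos_pos zero_less_power) auto
    have "ln Y = ln 2 + 2 * ln (real (K * T)) + 2 * real K * ln (21 * real M) + 2 * (real T * M) * ln c"
    proof -
      have "K > 0" "T > 0" using KT1 by (auto intro!: Nat.gr0I)
      then show ?thesis
        unfolding Y_def using Mx(2) c by (simp add: ln_mult ln_realpow algebra_simps)
    qed
    also have "\<dots> \<le> ln 2 + 2 * ln (2 * (real D)\<^sup>2 * (real M)\<^sup>2) + 4 * (real D)\<^sup>2 * (M * sqrt M) * ln (21 * real M)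
      + 2 * (M * sqrt M) * ln c"
    proof (intro add_mono mult_right_mono)
      show "2 * ln (real (K * T)) \<le> 2 * ln (2 * (real D)\<^sup>2 * (real M)\<^sup>2)"
        using KT KT1 by (intro mult_left_mono ln_mono) linarith+
      show "2 * real K \<le> 4 * (real D)\<^sup>2 * (M * sqrt M)" using K' by linarith
      show "2 * (real T * M) \<le> 2 * (M * sqrt M)" using TMs by linarith
    qed (use c Mx in auto)
    finally have "(real D + 1) * ln Y \<le> (real D + 1) * (ln 2 + 2 * ln (2 * (real D)\<^sup>2 * (real M)\<^sup>2)
      + 4 * (real D)\<^sup>2 * (M * sqrt M) * ln (21 * real M) + 2 * (M * sqrt M) * ln c)"
      by (rule mult_left_mono) simp
    also have "\<dots> < (real M)\<^sup>2 * ln 3" by (rule x0[OF Mx(1)])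
    also have "(real D + 1) * ln Y = ln (Y ^ (D + 1))" using Y by (subst ln_realpow) auto
    also have "(real M)\<^sup>2 * ln 3 = ln (3 ^ (M ^ 2))" by (subst ln_realpow) auto
    finally have "ln (Y ^ (D + 1)) < ln (3 ^ (M ^ 2))" .
    then have "Y ^ (D + 1) < 3 ^ (M ^ 2)" using Y by (subst (asm) ln_less_cancel_iff) auto
    then show "(2 * real (K * T) ^ 2 * (21 * real M) ^ (2 * K) * (C * exp 66) ^ (2 * T * M)) ^ (D + 1) < 3 ^ (M ^ 2)"
      by (simp add: Y_def c_def)
  qed
qed

lemma tau_transcendental: "\<not> algebraic tau"
proof
  assume "algebraic tau"
  then obtain D v q C where D: "0 < D" "v 0 \<noteq> 0" and q: "q \<noteq> 0" "\<bar>q\<bar> \<le> C"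
    and size: "size_le D v (of_real (sqrt 2)) 2" "size_le D v (of_int q * tau) C"
    by (rule algebraic_order)
  have C: "C \<ge> 1" using q by linarith
  obtain T where T: "T \<ge> 1" and small: "\<And>M K. M \<ge> T ^ 2 \<Longrightarrow> K = 2 * D ^ 2 * T ^ 3 \<Longrightarrow>
    (2 * real (K * T) ^ 2 * (21 * real M) ^ (2 * K) * (of_int C * exp 66) ^ (2 * T * M)) ^ (D + 1) < 3 ^ (M ^ 2)"
    using schneider_parameters[of D "of_int C"] D(1) C by (auto simp: Suc_leI)
  \<comment> \<open>There are \<open>K * T = 2 * D ^ 2 * T ^ 4\<close> unknown coefficients. The
    \<open>N ^ 2 = T ^ 4\<close> nodes impose \<open>D ^ 2\<close> integer equations each, exactly
    half as many, as Siegel's lemma requires.\<close>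
  define K where "K = 2 * D ^ 2 * T ^ 3"
  define N where "N = T ^ 2"
  define U where "U = {..<K} \<times> {..<T}"
  have N: "N \<ge> 1" using T by (simp add: N_def)
  have K: "K \<ge> 1" using T D(1) by (simp add: K_def Suc_leI)
  have card_U: "card U = K * T" by (simp add: U_def)

  \<comment> \<open>The factor \<open>q ^ (T * M)\<close> clears denominators:
    \<open>q ^ (l * m)\<close> is absorbed into the power of \<open>tau\<close>, and the remaining
    power of \<open>q\<close> is an integer of size at most
    \<open>C ^ (T * M - l * m)\<close>.\<close>
  have expmon_size: "size_le D v (of_int q ^ (T * M) * expmon u (node n m)) ((3 * int M) ^ K * C ^ (T * M))"
    if asm: "n \<le> M" "m \<le> M" "1 \<le> M" "u \<in> U" for M n m u
  proof -
    obtain k l where u: "u = (k, l)" "k < K" "l < T" using asm by (auto simp: U_def)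
    have lm: "l * m \<le> T * M" using asm u by (intro mult_mono) auto
    have "size_le D v (of_int (int n) + of_int (int m) * of_real (sqrt 2)) (\<bar>int n\<bar> + \<bar>int m\<bar> * 2)"
      by (intro size_le_add size_le_mult size_le_of_int size) auto
    then have "size_le D v (node n m) (3 * int M)"
      by (rule size_le_mono[OF back_subst[of "\<lambda>z. size_le D v z _"]]) (use asm in \<open>auto simp: node_def\<close>)
    then have "size_le D v (node n m ^ k) ((3 * int M) ^ k)" by (rule size_le_power) simp
    then have 1: "size_le D v (node n m ^ k) ((3 * int M) ^ K)"
    proof (rule size_le_mono)
      show "(3 * int M) ^ k \<le> (3 * int M) ^ K" using asm u by (intro power_increasing) auto
    qed
    have "size_le D v (of_int (q ^ (T * M - l * m))) \<bar>q ^ (T * M - l * m)\<bar>" by (rule size_le_of_int)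
    moreover have "\<bar>q ^ (T * M - l * m)\<bar> \<le> C ^ (T * M - l * m)"
      using q by (simp add: power_abs power_mono)
    ultimately have 2: "size_le D v (of_int (q ^ (T * M - l * m))) (C ^ (T * M - l * m))"
      by (rule size_le_mono)
    have 3: "size_le D v ((of_int q * tau) ^ (l * m)) (C ^ (l * m))"
      using size(2) C by (intro size_le_power) auto
    have 4: "size_le D v (of_int ((-1) ^ (l * n))) 1"
      using size_le_of_int[of D v "(-1) ^ (l * n)"] by simp
    have "size_le D v (node n m ^ k * (of_int ((-1) ^ (l * n)) * (of_int (q ^ (T * M - l * m)) * (of_int q * tau) ^ (l * m))))
      ((3 * int M) ^ K * (1 * (C ^ (T * M - l * m) * C ^ (l * m))))"
      using C by (intro size_le_mult 1 2 3 4) auto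
    also have "C ^ (T * M - l * m) * C ^ (l * m) = C ^ (T * M)" using lm by (simp flip: power_add)
    also have "node n m ^ k * (of_int ((-1) ^ (l * n)) * (of_int (q ^ (T * M - l * m)) * (of_int q * tau) ^ (l * m)))
      = of_int q ^ (T * M) * expmon u (node n m)"
    proof -
      have "(of_int q :: complex) ^ (T * M) = of_int q ^ (T * M - l * m) * of_int q ^ (l * m)"
        using lm by (simp flip: power_add)
      then show ?thesis by (simp add: u(1) expmon_node power_mult_distrib mult_ac)
    qed
    finally show ?thesis by simp
  qed

  define A where "A = (3 * int N) ^ K * C ^ (T * N)"
  have A: "A \<ge> 1"
  proof -
    have "(3 * int N) ^ K \<ge> 1" "C ^ (T * N) \<ge> 1" by (rule one_le_power, use N C in simp)+
    then show ?thesis unfolding A_def using mult_mono[of 1 "(3 * int N) ^ K" 1 "C ^ (T * N)"] by simp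
  qed
  define X where "X = 2 * int (card U) * A"
  obtain a where a: "\<exists>u\<in>U. a u \<noteq> 0" "\<And>u. u \<in> U \<Longrightarrow> \<bar>a u\<bar> \<le> X"
    and init: "\<And>n m. n < N \<Longrightarrow> m < N \<Longrightarrow> expoly a U (node n m) = 0"
  proof -
    let ?N = "{..<N} \<times> {..<N}"
    have "\<exists>M. acts_as D v M (of_int q ^ (T * N) * expmon u (case_prod node p)) \<and> rows_le D M A"
      if "u \<in> U" "p \<in> ?N" for u p
      using expmon_size[of "fst p" N "snd p" u] that N by (auto simp: size_le_def A_def)
    then obtain M where M: "\<And>u p. u \<in> U \<Longrightarrow> p \<in> ?N \<Longrightarrow>
        acts_as D v (M u p) (of_int q ^ (T * N) * expmon u (case_prod node p)) \<and> rows_le D (M u p) A"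
      by metis
    \<comment> \<open>One equation for each node and each entry of the matrix that represents the
      value there; a zero matrix forces a zero value because \<open>v 0 \<noteq> 0\<close>.\<close>
    define E where "E = ?N \<times> ({..<D} \<times> {..<D})"
    define c where "c = (\<lambda>(p, i, j) u. M u p i j)"
    obtain x where x: "\<exists>u\<in>U. x u \<noteq> 0" "\<And>u. u \<in> U \<Longrightarrow> \<bar>x u\<bar> \<le> 2 * int (card U) * A"
      "\<And>e. e \<in> E \<Longrightarrow> (\<Sum>u\<in>U. c e u * x u) = 0"
    proof (rule siegel_lemma[of E U A c])
      show "2 * card E \<le> card U"
        by (simp add: E_def card_U K_def N_def power_numeral_reduce)
      show "U \<noteq> {}" using K T by (auto simp: U_def lessThan_empty_iff)
      show "\<bar>c e u\<bar> \<le> A" if "e \<in> E" "u \<in> U" for e u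
        using that(1) M[OF that(2), of "fst e"] by (auto simp: c_def E_def intro!: rows_le_entry)
    qed (use A in \<open>auto simp: E_def U_def\<close>)
    show thesis
    proof (rule that[OF x(1)])
      show "\<bar>x u\<bar> \<le> X" if "u \<in> U" for u using x(2)[OF that] by (simp add: X_def)
      fix n m assume nm: "n < N" "m < N"
      have "acts_as D v (\<lambda>i j. \<Sum>u\<in>U. M u (n, m) i j * x u)
          (\<Sum>u\<in>U. of_int q ^ (T * N) * expmon u (node n m) * of_int (x u))"
        by (rule acts_as_sum) (use M[of _ "(n, m)"] nm in auto)
      then have "(\<Sum>u\<in>U. of_int q ^ (T * N) * expmon u (node n m) * of_int (x u)) = 0"
      proof (rule acts_as_zero_matrix)
        fix i j assume "i < D" "j < D"
        then show "(\<Sum>u\<in>U. M u (n, m) i j * x u) = 0"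
          using x(3)[of "((n, m), i, j)"] nm by (simp add: c_def E_def)
      qed (use D in auto)
      then have "of_int q ^ (T * N) * expoly x U (node n m) = 0"
        by (simp add: expoly_def sum_distrib_left mult_ac)
      then show "expoly x U (node n m) = 0" using q by simp
    qed
  qed

  \<comment> \<open>Zeros with indices below \<open>M\<close> extend to indices up to
    \<open>M\<close>. A nonzero value would be at least \<open>B\<close> to the power
    \<open>-D\<close> after scaling by Liouville, yet at most \<open>Y / 3 ^ (M ^ 2)\<close> by the
    Schwarz lemma.\<close>
  have step: "expoly a U (node n m) = 0"
    if M: "N \<le> M" and zero: "\<And>n m. n < M \<Longrightarrow> m < M \<Longrightarrow> expoly a U (node n m) = 0"
      and nm: "n \<le> M" "m \<le> M" for M n m
  proof (rule ccontr)
    assume nz: "expoly a U (node n m) \<noteq> 0"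
    define w where "w = node n m"
    define g where "g = of_int q ^ (T * M) * expoly a U w"
    define B where "B = int (card U) * (X * ((3 * int M) ^ K * C ^ (T * M)))"
    \<comment> \<open>A common upper bound for the size \<open>B\<close> and for
      \<open>3 ^ (M ^ 2) * cmod g\<close>, so the contradiction reads
      \<open>3 ^ (M ^ 2) \<le> Y ^ (D + 1)\<close>.\<close>
    define Y where "Y = 2 * real (K * T) ^ 2 * (21 * real M) ^ (2 * K) * (of_int C * exp 66) ^ (2 * T * M)"
    have M1: "M \<ge> 1" using M N by simp
    have KT: "1 \<le> int (K * T)" using mult_mono[of 1 "int K" 1 "int T"] K T by simp
    have "1 * 1 \<le> 2 * int (K * T) * A" using KT A by (intro mult_mono) auto
    then have X: "X \<ge> 1" by (simp add: X_def card_U)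
    have A_le: "A \<le> (3 * int M) ^ K * C ^ (T * M)"
      unfolding A_def using M C by (intro mult_mono power_mono power_increasing) auto

    have "size_le D v g (\<Sum>u\<in>U. X * ((3 * int M) ^ K * C ^ (T * M)))"
    proof -
      have "size_le D v (\<Sum>u\<in>U. of_int (a u) * (of_int q ^ (T * M) * expmon u w))
         (\<Sum>u\<in>U. X * ((3 * int M) ^ K * C ^ (T * M)))"
        unfolding w_def using nm M1 C
        by (intro size_le_sum size_le_mult expmon_size size_le_mono[OF size_le_of_int a(2)]) auto
      then show ?thesis by (simp add: g_def expoly_def sum_distrib_left mult_ac)
    qed
    then have g_size: "size_le D v g B" by (simp add: B_def)
    have B1: "B \<ge> 1"
    proof -
      have "(3 * int M) ^ K * C ^ (T * M) \<ge> 1" using A A_le by simp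
      then have "1 * (1 * 1) \<le> int (K * T) * (X * ((3 * int M) ^ K * C ^ (T * M)))"
        using X KT by (intro mult_mono) auto
      then show ?thesis by (simp add: B_def card_U)
    qed
    have "g \<noteq> 0" using nz q by (simp add: g_def w_def)
    then have lower: "1 \<le> cmod g * real_of_int B ^ D"
      by (rule size_le_lower_bound[where B = B and D = D and v = v, OF g_size _ B1 D(1) D(2)])

    \<comment> \<open>Nodes with indices up to \<open>M\<close> lie in the disc of radius
      \<open>3 * M\<close>, so the function is estimated on the circle of radius
      \<open>21 * M\<close>.\<close>
    have "3 ^ card (case_prod node ` ({..<M} \<times> {..<M})) * cmod (expoly a U w)
      \<le> real (K * T) * X * ((7 * (3 * real M)) ^ K * exp (pi * T * (7 * (3 * real M))))"
    proof (rule schwarz_lemma_zeros[where f = "expoly a U" and r = "3 * real M"])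
      show "expoly a U b = 0" if "b \<in> case_prod node ` ({..<M} \<times> {..<M})" for b
        using that zero by auto
      show "cmod b \<le> 3 * real M" if "b \<in> case_prod node ` ({..<M} \<times> {..<M})" for b
        using that cmod_node_le[of _ M] by auto
      show "cmod w \<le> 3 * real M" unfolding w_def by (rule cmod_node_le[OF nm])
      show "cmod (expoly a U z) \<le> real (K * T) * X * ((7 * (3 * real M)) ^ K * exp (pi * T * (7 * (3 * real M))))"
        if "cmod z = 7 * (3 * real M)" for z
        unfolding U_def using a(2) that M1 by (intro expoly_bound) (auto simp: U_def)
    qed (use M1 expoly_holomorphic in auto)
    also have "card (case_prod node ` ({..<M} \<times> {..<M})) = M ^ 2"
      by (subst card_image) (auto simp: inj_on_def power2_eq_square)
    finally have upper: "3 ^ (M ^ 2) * cmod (expoly a U w)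
      \<le> real (K * T) * X * ((21 * real M) ^ K * exp (21 * pi * T * M))"
      by (simp add: mult_ac)

    have X_le: "real_of_int X \<le> 2 * real (K * T) * ((21 * real M) ^ K * of_int C ^ (T * M))"
    proof -
      have "real_of_int A \<le> of_int ((3 * int M) ^ K * C ^ (T * M))" using A_le by (simp only: of_int_le_iff)
      also have "\<dots> = (3 * real M) ^ K * of_int C ^ (T * M)" by simp
      also have "\<dots> \<le> (21 * real M) ^ K * of_int C ^ (T * M)"
        using C by (intro mult_right_mono power_mono) auto
      finally show ?thesis by (simp add: X_def card_U mult_left_mono)
    qed
    \<comment> \<open>The constant 66 exceeds \<open>21 * pi\<close>, so \<open>exp 66\<close>
      absorbs the exponential growth on that circle.\<close>
    have c66: "(of_int C * exp 66) ^ (T * M) \<ge> (of_int C :: real) ^ (T * M)"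
      "(of_int C * exp 66) ^ (T * M) \<ge> of_int C ^ (T * M) * exp (21 * pi * T * M)"
    proof -
      show "(of_int C * exp 66) ^ (T * M) \<ge> (of_int C :: real) ^ (T * M)"
        using C by (intro power_mono) auto
      have "21 * pi * T * M \<le> 66 * (real T * real M)"
        using pi_less_4 pi_approx(2) mult_right_mono[of "21 * pi" 66 "real T * real M"] by (simp add: mult_ac)
      then have "exp (21 * pi * T * M) \<le> exp 66 ^ (T * M)"
        by (simp flip: exp_of_nat_mult add: mult_ac)
      then show "(of_int C * exp 66) ^ (T * M) \<ge> of_int C ^ (T * M) * exp (21 * pi * T * M)"
        using C by (simp add: power_mult_distrib mult_left_mono)
    qed
    have Y_eq: "Y = real (K * T) * (2 * real (K * T) * ((21 * real M) ^ K * (of_int C * exp 66) ^ (T * M)))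
        * ((21 * real M) ^ K * (of_int C * exp 66) ^ (T * M))"
    proof -
      have p2: "x ^ (2 * k) = x ^ k * x ^ k" for x :: real and k by (simp add: mult_2 power_add)
      show ?thesis unfolding Y_def mult.assoc[of 2 T M] p2 power2_eq_square by (simp only: mult_ac)
    qed
    have X_le': "real_of_int X \<le> 2 * real (K * T) * ((21 * real M) ^ K * (of_int C * exp 66) ^ (T * M))"
      by (rule order.trans[OF X_le]) (intro mult_left_mono c66, auto)
    have B_Y: "real_of_int B \<le> Y"
    proof -
      have "real_of_int B = real (K * T) * X * ((3 * real M) ^ K * of_int C ^ (T * M))"
        by (simp add: B_def card_U)
      also have "\<dots> \<le> Y"
        unfolding Y_eq using X C X_le' c66(1) by (intro mult_mono mult_nonneg_nonneg power_mono) auto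
      finally show ?thesis .
    qed
    have "3 ^ (M ^ 2) \<le> 3 ^ (M ^ 2) * (cmod g * real_of_int B ^ D)" using lower by simp
    also have "\<dots> = (of_int \<bar>q\<bar> ^ (T * M) * (3 ^ (M ^ 2) * cmod (expoly a U w))) * real_of_int B ^ D"
      by (simp add: g_def norm_mult norm_power mult_ac)
    also have "\<dots> \<le> Y * Y ^ D"
    proof (intro mult_mono power_mono B_Y)
      have "of_int \<bar>q\<bar> ^ (T * M) * (3 ^ (M ^ 2) * cmod (expoly a U w))
        \<le> of_int C ^ (T * M) * (real (K * T) * X * ((21 * real M) ^ K * exp (21 * pi * T * M)))"
        using q C by (intro mult_mono[OF _ upper] power_mono) auto
      also have "\<dots> = real (K * T) * X * ((21 * real M) ^ K * (of_int C ^ (T * M) * exp (21 * pi * T * M)))"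
        by (simp add: mult_ac)
      also have "\<dots> \<le> Y"
        unfolding Y_eq using X C X_le' c66(2) by (intro mult_mono mult_nonneg_nonneg power_mono) auto
      finally show "of_int \<bar>q\<bar> ^ (T * M) * (3 ^ (M ^ 2) * cmod (expoly a U w)) \<le> Y" .
    qed (use B1 B_Y in auto)
    also have "\<dots> < 3 ^ (M ^ 2)"
      using small[of M K] M by (simp add: Y_def K_def N_def)
    finally show False by simp
  qed

  have all: "\<forall>n m. n < N + j \<longrightarrow> m < N + j \<longrightarrow> expoly a U (node n m) = 0" for j
  proof (induction j)
    case (Suc j)
    then show ?case using step[of "N + j"] by (auto simp: less_Suc_eq_le)
  qed (use init in auto)
  have "expoly a U (node n m) = 0" for n m
    using all[of "n + m + 1"] by simp
  then have "a u = 0" if "u \<in> U" for u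
    using that expoly_all_nodes_zero[of a K T] by (auto simp: U_def)
  then show False using a(1) by blast
qed

section \<open>Products of twisted rotations\<close>

definition mat22 :: "'a \<Rightarrow> 'a \<Rightarrow> 'a \<Rightarrow> 'a \<Rightarrow> 'a mat" where
  "mat22 a b c d = mat 2 2 (\<lambda>(i,j). if i = 0 then (if j = 0 then a else b) else (if j = 0 then c else d))"

lemma mat22_carrier [simp]: "mat22 a b c d \<in> carrier_mat 2 2"
  by (simp add: mat22_def)

lemma mat22_index [simp]:
  "mat22 a b c d $$ (0, 0) = a" "mat22 a b c d $$ (0, Suc 0) = b"
  "mat22 a b c d $$ (Suc 0, 0) = c" "mat22 a b c d $$ (Suc 0, Suc 0) = d"
  by (simp_all add: mat22_def)

lemma less_2_cases': "i < 2 \<longleftrightarrow> i = 0 \<or> i = Suc 0"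
  by auto

lemma mat22_eqI:
  assumes "A \<in> carrier_mat 2 2" "A $$ (0,0) = a" "A $$ (0,1) = b" "A $$ (1,0) = c" "A $$ (1,1) = d"
  shows "A = mat22 a b c d"
  using assms by (intro eq_matI) (auto simp: mat22_def less_2_cases')

lemma mat22_exhaust:
  assumes "A \<in> carrier_mat 2 2"
  obtains a b c d where "A = mat22 a b c d"
  using mat22_eqI[OF assms] by blast

lemma mat22_mult [simp]:
  fixes a :: "'a::semiring_0"
  shows "mat22 a b c d * mat22 a' b' c' d'
    = mat22 (a * a' + b * c') (a * b' + b * d') (c * a' + d * c') (c * b' + d * d')"
  by (rule mat22_eqI) (auto simp: mat22_def scalar_prod_def numeral_2_eq_2)

lemma one_mat22: "1\<^sub>m 2 = mat22 1 0 0 1"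
  by (rule mat22_eqI) auto

lemma mat22_inject [simp]: "mat22 a b c d = mat22 a' b' c' d' \<longleftrightarrow> a = a' \<and> b = b' \<and> c = c' \<and> d = d'"
  by (metis mat22_index)

lemma elements_mat22: "elements_mat (mat22 a b c d) = {a, b, c, d}"
  by (auto simp: elements_mat_def mat22_def less_2_cases' numeral_2_eq_2)

lemma mat_adjoint_carrier [simp]: "A \<in> carrier_mat n n \<Longrightarrow> mat_adjoint A \<in> carrier_mat n n"
  unfolding mat_adjoint_def by (auto simp: mat_of_rows_def)

lemma mat_adjoint_index [simp]:
  "A \<in> carrier_mat n n \<Longrightarrow> i < n \<Longrightarrow> j < n \<Longrightarrow> mat_adjoint A $$ (i, j) = conjugate (A $$ (j, i))"
  unfolding mat_adjoint_def by (auto simp: mat_of_rows_def)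

lemma mat_adjoint_mult:
  assumes "A \<in> carrier_mat n n" "B \<in> carrier_mat n n"
  shows "mat_adjoint (A * B) = mat_adjoint B * mat_adjoint (A :: complex mat)"
proof (rule eq_matI)
  fix i j assume "i < dim_row (mat_adjoint B * mat_adjoint A)" "j < dim_col (mat_adjoint B * mat_adjoint A)"
  then have ij: "i < n" "j < n" using assms mat_adjoint_carrier by (metis carrier_matD index_mult_mat(2,3))+
  have AB: "A * B \<in> carrier_mat n n" using assms by simp
  have "mat_adjoint (A * B) $$ (i, j) = cnj (\<Sum>k<n. A $$ (j, k) * B $$ (k, i))"
    using mat_adjoint_index[OF AB ij] assms ij by (simp add: scalar_prod_def atLeast0LessThan)
  also have "\<dots> = (\<Sum>k<n. mat_adjoint B $$ (i, k) * mat_adjoint A $$ (k, j))"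
    using assms ij by (simp add: mult.commute)
  also have "\<dots> = (mat_adjoint B * mat_adjoint A) $$ (i, j)"
    using assms[THEN mat_adjoint_carrier] ij by (simp add: scalar_prod_def atLeast0LessThan)
  finally show "mat_adjoint (A * B) $$ (i, j) = (mat_adjoint B * mat_adjoint A) $$ (i, j)" .
next
  have "A * B \<in> carrier_mat n n" using assms by simp
  from mat_adjoint_carrier[OF this] assms[THEN mat_adjoint_carrier]
  show "dim_row (mat_adjoint (A * B)) = dim_row (mat_adjoint B * mat_adjoint A)"
    "dim_col (mat_adjoint (A * B)) = dim_col (mat_adjoint B * mat_adjoint A)"
    by auto
qed

lemma mat_adjoint_one: "mat_adjoint (1\<^sub>m n) = (1\<^sub>m n :: complex mat)"
  by (rule eq_matI) (auto simp: mat_adjoint_def mat_of_rows_def)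

lemma mat_adjoint_mat22: "mat_adjoint (mat22 a b c d) = mat22 (cnj a) (cnj c) (cnj b) (cnj d)"
  by (rule mat22_eqI) (auto simp: mat_adjoint_index[where n = 2])

lemma unitary_group_mult_closed:
  assumes "U \<in> carrier (unitary_group d)" "V \<in> carrier (unitary_group d)"
  shows "U * V \<in> carrier (unitary_group d)"
proof -
  have c: "U \<in> carrier_mat d d" "V \<in> carrier_mat d d"
    and U: "U * mat_adjoint U = 1\<^sub>m d" "mat_adjoint U * U = 1\<^sub>m d"
    and V: "V * mat_adjoint V = 1\<^sub>m d" "mat_adjoint V * V = 1\<^sub>m d"
    using assms by (auto simp: unitary_group_def)
  note c' = c[THEN mat_adjoint_carrier]
  have "(U * V) * (mat_adjoint V * mat_adjoint U) = U * (V * (mat_adjoint V * mat_adjoint U))"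
    by (rule assoc_mult_mat[OF c mult_carrier_mat[OF c'(2,1)]])
  also have "V * (mat_adjoint V * mat_adjoint U) = (V * mat_adjoint V) * mat_adjoint U"
    by (rule assoc_mult_mat[OF c(2) c'(2,1), symmetric])
  finally have 1: "(U * V) * (mat_adjoint V * mat_adjoint U) = 1\<^sub>m d"
    using U V c' by simp
  have "(mat_adjoint V * mat_adjoint U) * (U * V) = mat_adjoint V * (mat_adjoint U * (U * V))"
    by (rule assoc_mult_mat[OF c'(2,1) mult_carrier_mat[OF c]])
  also have "mat_adjoint U * (U * V) = (mat_adjoint U * U) * V"
    by (rule assoc_mult_mat[OF c'(1) c, symmetric])
  finally have 2: "(mat_adjoint V * mat_adjoint U) * (U * V) = 1\<^sub>m d"
    using U V c by simp
  show ?thesis using 1 2 c by (simp add: unitary_group_def mat_adjoint_mult[OF c])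
qed

lemma monoid_unitary_group: "Group.monoid (unitary_group d)"
proof (rule monoidI)
  show "x \<otimes>\<^bsub>unitary_group d\<^esub> y \<in> carrier (unitary_group d)"
    if "x \<in> carrier (unitary_group d)" "y \<in> carrier (unitary_group d)" for x y
    using unitary_group_mult_closed[OF that] by (simp add: unitary_group_def)
qed (auto simp: unitary_group_def mat_adjoint_one intro!: assoc_mult_mat)

text \<open>Rows have norm one, so a nonzero off-diagonal entry in the first row makes the first
  diagonal entry smaller than 1 in modulus, while the second is at most 1.\<close>

lemma unitary_trace_less_2:
  assumes A: "A \<in> carrier (unitary_group 2)" and nz: "A $$ (0, 1) \<noteq> 0"
  shows "cmod (mat_trace A) < 2"
proof -
  obtain a b c d where A_eq: "A = mat22 a b c d"
    using A by (auto simp: unitary_group_def elim: mat22_exhaust)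
  have "a * cnj a + b * cnj b = 1" "c * cnj c + d * cnj d = 1"
    using A by (auto simp: unitary_group_def A_eq mat_adjoint_mat22 one_mat22)
  then have "complex_of_real ((cmod a)\<^sup>2 + (cmod b)\<^sup>2) = of_real 1" "complex_of_real ((cmod c)\<^sup>2 + (cmod d)\<^sup>2) = of_real 1"
    by (simp_all add: complex_norm_square del: of_real_power)
  then have "(cmod a)\<^sup>2 + (cmod b)\<^sup>2 = 1" "(cmod c)\<^sup>2 + (cmod d)\<^sup>2 = 1"
    unfolding of_real_eq_iff by auto
  moreover have "(cmod b)\<^sup>2 > 0" using nz by (simp add: A_eq)
  ultimately have "(cmod a)\<^sup>2 < 1" "(cmod d)\<^sup>2 \<le> 1"
    using zero_le_power2[of "cmod c"] by linarith+
  then have "cmod a < 1" "cmod d \<le> 1"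
    by (simp_all add: abs_square_less_1 abs_square_le_1)
  moreover have "cmod (a + d) \<le> cmod a + cmod d" by (rule norm_triangle_ineq)
  moreover have "mat_trace A = a + d" by (simp add: mat_trace_def A_eq mat22_def numeral_2_eq_2)
  ultimately show ?thesis by simp
qed

text \<open>Conjugating the rotation of angle \<open>arg u\<close> by the \<open>j\<close>-th power of \<open>diag(tau, 1)\<close>.\<close>
definition twisted_rotation :: "nat \<Rightarrow> complex \<Rightarrow> complex mat" where
  "twisted_rotation j u = mat22 (Re u) (- (Im u * tau ^ j)) (Im u * inverse tau ^ j) (Re u)"

lemma tau_nonzero [simp]: "tau \<noteq> 0"
  by (simp add: tau_def)

lemma cnj_tau: "cnj tau = inverse tau"
  by (simp add: tau_def exp_cnj exp_minus)

lemma tau_power_cancel [simp]: "tau ^ j * inverse tau ^ j = 1" "inverse tau ^ j * tau ^ j = 1"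
  by (simp_all flip: power_mult_distrib)

lemma twisted_rotation_carrier [simp]: "twisted_rotation j u \<in> carrier_mat 2 2"
  by (simp add: twisted_rotation_def)

lemma twisted_rotation_mult:
  "twisted_rotation j u * twisted_rotation j w = twisted_rotation j (u * w)"
proof -
  have "x * tau ^ j * (y * inverse tau ^ j) = x * y" "x * inverse tau ^ j * (y * tau ^ j) = x * y" for x y
    using tau_power_cancel[of j] by (simp_all add: mult_ac)
  then show ?thesis by (simp add: twisted_rotation_def algebra_simps)
qed

lemma twisted_rotation_one: "twisted_rotation j 1 = 1\<^sub>m 2"
  by (simp add: twisted_rotation_def one_mat22)

lemma twisted_rotation_adjoint: "mat_adjoint (twisted_rotation j u) = twisted_rotation j (cnj u)"
  by (simp add: twisted_rotation_def mat_adjoint_mat22 cnj_tau)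

lemma twisted_rotation_unitary:
  assumes "cmod u = 1"
  shows "twisted_rotation j u \<in> carrier (unitary_group 2)"
proof -
  have "u * cnj u = 1" using assms by (simp add: complex_norm_square[symmetric])
  then show ?thesis
    by (simp add: unitary_group_def twisted_rotation_adjoint twisted_rotation_mult twisted_rotation_one mult.commute)
qed

text \<open>The exponents are \<open>j * sqrt 2\<close> and its negative, real roots of
  \<open>X ^ 2 - 2 * j ^ 2\<close>.\<close>

lemma Ctilde_tau_power: "tau ^ j \<in> Ctilde" "inverse tau ^ j \<in> Ctilde"
proof -
  have alg: "algebraic (complex_of_real (x * sqrt 2))" if x: "x \<in> \<int>" for x
  proof (rule algebraicI)
    let ?p = "[: - (of_real (2 * x\<^sup>2)), 0, 1 :] :: complex poly"
    show "poly ?p (complex_of_real (x * sqrt 2)) = 0"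
      by (simp add: power2_eq_square algebra_simps flip: of_real_mult)
    show "?p \<noteq> 0" by simp
    obtain z where z: "x = of_int z" using x by (rule Ints_cases)
    have "complex_of_real (2 * x\<^sup>2) = of_int (2 * z\<^sup>2)" by (simp add: z)
    then have "complex_of_real (2 * x\<^sup>2) \<in> \<int>" by (metis Ints_of_int)
    then show "coeff ?p i \<in> \<int>" for i by (auto simp: coeff_pCons split: nat.splits)
  qed
  have eq: "tau ^ j = exp (complex_of_real pi * \<i> * complex_of_real (real j * sqrt 2))"
    "inverse tau ^ j = exp (complex_of_real pi * \<i> * complex_of_real (- real j * sqrt 2))"
    by (simp_all add: tau_def exp_of_nat_mult[symmetric] exp_minus[symmetric] algebra_simps)
  show "tau ^ j \<in> Ctilde"
    unfolding Ctilde_def by (intro UnI2 CollectI exI[of _ "real j * sqrt 2"] conjI alg eq(1)) simp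
  show "inverse tau ^ j \<in> Ctilde"
    unfolding Ctilde_def by (intro UnI2 CollectI exI[of _ "- real j * sqrt 2"] conjI alg eq(2)) simp
qed

lemma Ctilde_rational: "z \<in> \<rat> \<Longrightarrow> z \<in> Ctilde"
  by (simp add: Ctilde_def rat_imp_algebraic)

text \<open>An entry such as \<open>Im u * tau ^ j\<close> need not lie in \<open>Ctilde\<close>.
  Undoing the conjugation leaves a rational rotation between two diagonal matrices, all with entries
  in \<open>Ctilde\<close>.\<close>

definition twisted_rotation_factors :: "nat \<Rightarrow> complex \<Rightarrow> complex mat list" where
  "twisted_rotation_factors j u =
    [mat22 (tau ^ j) 0 0 1, mat22 (Re u) (- Im u) (Im u) (Re u), mat22 (inverse tau ^ j) 0 0 1]"

lemma twisted_rotation_factors: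
  assumes u: "cmod u = 1" "Re u \<in> \<rat>" "Im u \<in> \<rat>"
  shows "set (twisted_rotation_factors j u) \<subseteq> unitary_matrices_over 2 Ctilde"
    and "foldr (*) (twisted_rotation_factors j u) (1\<^sub>m 2) = twisted_rotation j u"
proof -
  have *: "complex_of_real (Re u) \<in> Ctilde" "complex_of_real (Im u) \<in> Ctilde" "- complex_of_real (Im u) \<in> Ctilde"
    "0 \<in> Ctilde" "1 \<in> Ctilde"
    using u by (auto intro!: Ctilde_rational simp: Rats_minus_iff)
  have n: "(Re u)\<^sup>2 + (Im u)\<^sup>2 = 1" using u(1) by (simp add: cmod_def)
  have "complex_of_real (Re u * Re u + Im u * Im u) = 1" using n by (simp add: power2_eq_square)
  then have n': "complex_of_real (Re u) * Re u + Im u * Im u = 1" by simp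
  show "set (twisted_rotation_factors j u) \<subseteq> unitary_matrices_over 2 Ctilde"
    using * Ctilde_tau_power[of j] n'
    by (auto simp: twisted_rotation_factors_def unitary_matrices_over_def unitary_group_def elements_mat22
        mat_adjoint_mat22 one_mat22 cnj_tau add.commute mult.commute)
  show "foldr (*) (twisted_rotation_factors j u) (1\<^sub>m 2) = twisted_rotation j u"
    by (simp add: twisted_rotation_factors_def twisted_rotation_def one_mat22 mult_ac)
qed

section \<open>Rational polynomials at tau and words of rotations\<close>

definition rational_poly :: "complex poly \<Rightarrow> bool" where
  "rational_poly p \<longleftrightarrow> (\<forall>i. coeff p i \<in> \<rat>)"

text \<open>The transcendence of \<open>tau\<close> enters the matrix argument here.\<close>

lemma rational_poly_tau_nonzero: "rational_poly p \<Longrightarrow> p \<noteq> 0 \<Longrightarrow> poly p tau \<noteq> 0"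
  using tau_transcendental algebraicI'[of p tau] by (auto simp: rational_poly_def)

lemma rational_poly_combination:
  assumes "rational_poly p" "rational_poly q" "a \<in> \<rat>" "b \<in> \<rat>"
  shows "rational_poly (Polynomial.smult a (monom 1 e * p) + Polynomial.smult b q)"
  using assms by (auto simp: rational_poly_def coeff_monom_mult)

text \<open>The shift by \<open>e > 0\<close> lifts the first summand above the second, so leading
  terms cannot cancel. The resulting degree is independent of \<open>a\<close> and \<open>b\<close>,
  hence the same for both coordinates of a rotated column.\<close>

lemma degree_combination:
  fixes p q :: "complex poly"
  assumes "degree p = degree q" "p \<noteq> 0" "a \<noteq> 0" "0 < e"
  shows "degree (Polynomial.smult a (monom 1 e * p) + Polynomial.smult b q) = e + degree p"
    and "Polynomial.smult a (monom 1 e * p) + Polynomial.smult b q \<noteq> 0"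
proof -
  have *: "degree (Polynomial.smult a (monom 1 e * p)) = e + degree p"
    using assms by (simp add: degree_mult_eq degree_monom_eq monom_eq_0_iff)
  have "degree (Polynomial.smult b q) \<le> degree q" by (rule degree_smult_le)
  then show d: "degree (Polynomial.smult a (monom 1 e * p) + Polynomial.smult b q) = e + degree p"
    using assms * by (subst degree_add_eq_left) auto
  show "Polynomial.smult a (monom 1 e * p) + Polynomial.smult b q \<noteq> 0"
    using d assms(4) by fastforce
qed

definition rotation_word :: "(nat \<times> complex) list \<Rightarrow> complex mat" where
  "rotation_word ws = foldr (\<lambda>(j, u). (*) (twisted_rotation j u)) ws (1\<^sub>m 2)"

lemma rotation_word_carrier: "rotation_word ws \<in> carrier_mat 2 2"
proof (induction ws)
  case (Cons x ws)
  then show ?case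
    by (cases x) (auto simp: rotation_word_def intro!: mult_carrier_mat[where n = 2])
qed (simp add: rotation_word_def)

text \<open>With \<open>\<Delta> = diag(tau, 1)\<close> and a first letter of index \<open>j\<close>, the second column of
  \<open>\<Delta>^-j * rotation_word ws\<close> is a multiple of \<open>(p tau, q tau)\<close>. Prepending a letter of another
  index multiplies exactly one of \<open>p\<close>, \<open>q\<close> by a power of the variable before rotating, so
  both new polynomials get the same, larger degree.\<close>
lemma rotation_word_column:
  assumes "\<And>w. w \<in> set ws \<Longrightarrow> Re (snd w) \<in> \<rat> \<and> Im (snd w) \<in> \<rat> \<and> Re (snd w) \<noteq> 0 \<and> Im (snd w) \<noteq> 0"
    and "distinct_adj (map fst ws)" "ws \<noteq> []"
  shows "\<exists>\<kappa> p q. \<kappa> \<noteq> 0 \<and> rational_poly p \<and> rational_poly q \<and> p \<noteq> 0 \<and> q \<noteq> 0 \<and> degree p = degree q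
    \<and> rotation_word ws $$ (0, 1) = \<kappa> * tau ^ fst (hd ws) * poly p tau
    \<and> rotation_word ws $$ (1, 1) = \<kappa> * poly q tau"
  using assms
proof (induction ws)
  case (Cons w ws)
  obtain i u where w: "w = (i, u)" by (cases w)
  define c s where "c = complex_of_real (Re u)" and "s = complex_of_real (Im u)"
  have cs: "c \<in> \<rat>" "s \<in> \<rat>" "c \<noteq> 0" "s \<noteq> 0"
    using Cons.prems(1)[of w] by (auto simp: w c_def s_def)
  then have ms: "- s \<in> \<rat>" "- s \<noteq> 0" by simp_all
  show ?case
  proof (cases "ws = []")
    case True
    have "rotation_word (w # ws) = mat22 c (- (s * tau ^ i)) (s * inverse tau ^ i) c"
      by (simp add: True w rotation_word_def twisted_rotation_def one_mat22 c_def s_def)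
    then have "rotation_word (w # ws) $$ (0, 1) = 1 * tau ^ fst (hd (w # ws)) * poly [: - s :] tau"
      "rotation_word (w # ws) $$ (1, 1) = 1 * poly [: c :] tau"
      by (simp_all add: w)
    moreover have "rational_poly [: - s :]" "rational_poly [: c :]"
      using cs by (auto simp: rational_poly_def coeff_pCons split: nat.splits)
    ultimately show ?thesis
      using cs by (intro exI[of _ 1] exI[of _ "[: - s :]"] exI[of _ "[: c :]"]) auto
  next
    case False
    define j where "j = fst (hd ws)"
    have ij: "i \<noteq> j" and adj: "distinct_adj (map fst ws)"
      using Cons.prems(2) False by (auto simp: w j_def distinct_adj_Cons hd_map)
    obtain \<kappa> p q where k: "\<kappa> \<noteq> 0" and p: "rational_poly p" "p \<noteq> 0" and q: "rational_poly q" "q \<noteq> 0"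
      and deg: "degree p = degree q"
      and x: "rotation_word ws $$ (0, 1) = \<kappa> * tau ^ j * poly p tau"
      and y: "rotation_word ws $$ (1, 1) = \<kappa> * poly q tau"
      using Cons.IH[OF Cons.prems(1) adj False] unfolding j_def by auto
    obtain a b a' b' where A: "rotation_word ws = mat22 a b a' b'"
      using mat22_exhaust[OF rotation_word_carrier] by blast
    have "rotation_word (w # ws) = mat22 c (- (s * tau ^ i)) (s * inverse tau ^ i) c * rotation_word ws"
      by (simp add: w rotation_word_def twisted_rotation_def c_def s_def)
    then have X: "rotation_word (w # ws) $$ (0, 1) = c * (\<kappa> * tau ^ j * poly p tau) - s * tau ^ i * (\<kappa> * poly q tau)"
      and Y: "rotation_word (w # ws) $$ (1, 1) = s * inverse tau ^ i * (\<kappa> * tau ^ j * poly p tau) + c * (\<kappa> * poly q tau)"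
      using x y by (simp_all add: A)
    have hd: "fst (hd (w # ws)) = i" by (simp add: w)
    show ?thesis
    proof (cases "i < j")
      case True
      \<comment> \<open>Passing from the twist \<open>j\<close> to the smaller twist
        \<open>i\<close> multiplies the first coordinate by \<open>tau ^ (j - i)\<close>.\<close>
      define e where "e = j - i"
      have e: "0 < e" "tau ^ j = tau ^ i * tau ^ e" using True by (auto simp: e_def simp flip: power_add)
      define p' where "p' = Polynomial.smult c (monom 1 e * p) + Polynomial.smult (- s) q"
      define q' where "q' = Polynomial.smult s (monom 1 e * p) + Polynomial.smult c q"
      have "rotation_word (w # ws) $$ (0, 1) = \<kappa> * tau ^ i * poly p' tau"
        unfolding X p'_def by (simp add: e poly_monom algebra_simps)
      moreover have "rotation_word (w # ws) $$ (1, 1) = \<kappa> * poly q' tau"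
        unfolding Y q'_def using tau_power_cancel[of i] by (simp add: e poly_monom algebra_simps)
      moreover have "degree p' = degree q'" "p' \<noteq> 0" "q' \<noteq> 0"
        unfolding p'_def q'_def by (simp_all only: degree_combination[OF deg p(2) cs(3) e(1)]
            degree_combination[OF deg p(2) cs(4) e(1)] not_False_eq_True)
      moreover have "rational_poly p'" "rational_poly q'"
        unfolding p'_def q'_def using rational_poly_combination p q cs(1,2) ms(1) by blast+
      ultimately show ?thesis unfolding hd using k by blast
    next
      case False
      define e where "e = i - j"
      have e: "0 < e" "tau ^ i = tau ^ j * tau ^ e" using False ij by (auto simp: e_def simp flip: power_add)
      define p' where "p' = Polynomial.smult (- s) (monom 1 e * q) + Polynomial.smult c p"
      define q' where "q' = Polynomial.smult c (monom 1 e * q) + Polynomial.smult s p"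
      \<comment> \<open>Here the change of twist divides the first coordinate by
        \<open>tau ^ e\<close>. Moving that denominator into the common scalar multiplies the second
        coordinate by \<open>tau ^ e\<close> instead and keeps both coordinates polynomial.\<close>
      define \<kappa>' where "\<kappa>' = \<kappa> * inverse tau ^ e"
      have "\<kappa>' * tau ^ e = \<kappa>" by (simp add: \<kappa>'_def mult.assoc)
      have "rotation_word (w # ws) $$ (0, 1) = \<kappa>' * tau ^ i * poly p' tau"
        unfolding X p'_def \<open>\<kappa>' * tau ^ e = \<kappa>\<close>[symmetric] by (simp add: e poly_monom algebra_simps)
      moreover have "rotation_word (w # ws) $$ (1, 1) = \<kappa>' * poly q' tau"
      proof -
        have "inverse tau ^ i * tau ^ j * tau ^ e = 1" by (simp add: e(2)[symmetric] mult.assoc)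
        then have "s * inverse tau ^ i * (\<kappa>' * tau ^ e * tau ^ j * poly p tau) = \<kappa>' * (s * poly p tau)"
          by (simp add: mult_ac)
        then show ?thesis
          unfolding Y q'_def \<open>\<kappa>' * tau ^ e = \<kappa>\<close>[symmetric] by (simp add: poly_monom algebra_simps)
      qed
      moreover have "degree p' = degree q'" "p' \<noteq> 0" "q' \<noteq> 0"
        unfolding p'_def q'_def by (simp_all only: degree_combination[OF deg[symmetric] q(2) ms(2) e(1)]
            degree_combination[OF deg[symmetric] q(2) cs(3) e(1)] not_False_eq_True)
      moreover have "rational_poly p'" "rational_poly q'"
        unfolding p'_def q'_def using rational_poly_combination p q cs(1,2) ms(1) by blast+
      moreover have "\<kappa>' \<noteq> 0" using k by (simp add: \<kappa>'_def)
      ultimately show ?thesis unfolding hd by blast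
    qed
  qed
qed simp

lemma rotation_word_off_diagonal:
  assumes "\<And>w. w \<in> set ws \<Longrightarrow> Re (snd w) \<in> \<rat> \<and> Im (snd w) \<in> \<rat> \<and> Re (snd w) \<noteq> 0 \<and> Im (snd w) \<noteq> 0"
    and "distinct_adj (map fst ws)" "ws \<noteq> []"
  shows "rotation_word ws $$ (0, 1) \<noteq> 0"
proof -
  obtain \<kappa> p where "\<kappa> \<noteq> 0" "rational_poly p" "p \<noteq> 0"
    "rotation_word ws $$ (0, 1) = \<kappa> * tau ^ fst (hd ws) * poly p tau"
    using rotation_word_column[OF assms] by blast
  then show ?thesis using rational_poly_tau_nonzero[of p] by simp
qed

section \<open>Multiplicatively independent Gaussian units\<close>

definition fermat_unit :: "nat \<Rightarrow> complex" where
  "fermat_unit j = (2 ^ (2 ^ j) + \<i>) / (2 ^ (2 ^ j) - \<i>)"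

definition unit_monomial :: "nat \<Rightarrow> (nat \<Rightarrow> int) \<Rightarrow> complex" where
  "unit_monomial n x = (\<Prod>k\<in>{1..n}. fermat_unit k powi x k)"

lemma fermat_unit_denom: "(2::complex) ^ (2 ^ j) - \<i> \<noteq> 0" "(2::complex) ^ (2 ^ j) + \<i> \<noteq> 0"
proof -
  have "Im ((2::complex) ^ (2 ^ j) - \<i>) \<noteq> 0" "Im ((2::complex) ^ (2 ^ j) + \<i>) \<noteq> 0" 
    by (simp_all add: Im_power_real)
  then show "(2::complex) ^ (2 ^ j) - \<i> \<noteq> 0" "(2::complex) ^ (2 ^ j) + \<i> \<noteq> 0" by (metis zero_complex.simps(2))+
qed

lemma fermat_unit_nonzero: "fermat_unit j \<noteq> 0"
  using fermat_unit_denom[of j] by (simp add: fermat_unit_def)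

lemma cmod_fermat_unit: "cmod (fermat_unit j) = 1"
proof -
  have "cnj ((2::complex) ^ (2 ^ j) + \<i>) = 2 ^ (2 ^ j) - \<i>" by simp
  then have "cmod ((2::complex) ^ (2 ^ j) - \<i>) = cmod ((2::complex) ^ (2 ^ j) + \<i>)"
    by (metis complex_mod_cnj)
  then show ?thesis using fermat_unit_denom[of j] by (simp add: fermat_unit_def norm_divide)
qed

section \<open>Gaussian rationals and unit monomials\<close>

definition gaussian_rat :: "complex \<Rightarrow> bool" where
  "gaussian_rat z \<longleftrightarrow> Re z \<in> \<rat> \<and> Im z \<in> \<rat>"

lemma gaussian_rat_mult: "gaussian_rat z \<Longrightarrow> gaussian_rat w \<Longrightarrow> gaussian_rat (z * w)"
  by (simp add: gaussian_rat_def)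

lemma gaussian_rat_inverse: "gaussian_rat z \<Longrightarrow> gaussian_rat (inverse z)"
  by (simp add: gaussian_rat_def)

lemma gaussian_rat_power: "gaussian_rat z \<Longrightarrow> gaussian_rat (z ^ n)"
  by (induction n) (auto intro: gaussian_rat_mult simp: gaussian_rat_def)

lemma gaussian_rat_power_int: "gaussian_rat z \<Longrightarrow> gaussian_rat (z powi n)"
  by (auto simp: power_int_def intro!: gaussian_rat_power gaussian_rat_inverse)

lemma gaussian_rat_fermat_unit: "gaussian_rat (fermat_unit j)"
proof -
  have "gaussian_rat ((2::complex) ^ (2 ^ j))" by (rule gaussian_rat_power) (simp add: gaussian_rat_def)
  then have "gaussian_rat ((2::complex) ^ (2 ^ j) + \<i>)" "gaussian_rat ((2::complex) ^ (2 ^ j) - \<i>)"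
    by (simp_all add: gaussian_rat_def)
  then show ?thesis unfolding fermat_unit_def divide_inverse by (intro gaussian_rat_mult gaussian_rat_inverse)
qed

lemma gaussian_rat_unit_monomial: "gaussian_rat (unit_monomial n x)"
  unfolding unit_monomial_def
proof (induction n)
  case (Suc n)
  then show ?case
    by (simp add: atLeastAtMostSuc_conv gaussian_rat_mult gaussian_rat_power_int gaussian_rat_fermat_unit)
qed (simp add: gaussian_rat_def)

lemma cmod_unit_monomial: "cmod (unit_monomial n x) = 1"
  by (simp add: unit_monomial_def prod_norm[symmetric] norm_power_int cmod_fermat_unit)

lemma unit_monomial_add:
  "(\<And>k. k \<in> {1..n} \<Longrightarrow> z k = x k + y k) \<Longrightarrow> unit_monomial n z = unit_monomial n x * unit_monomial n y"
  unfolding unit_monomial_def prod.distrib[symmetric]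
  by (intro prod.cong) (auto simp: power_int_add fermat_unit_nonzero)

lemma unit_monomial_power:
  "unit_monomial n x ^ m = unit_monomial n (\<lambda>k. x k * int m)"
  by (simp add: unit_monomial_def prod_power_distrib power_int_mult)

text \<open>An earlier Fermat number divides a later one minus 2: with
  \<open>y = 2 ^ 2 ^ (i + 1)\<close>, \<open>y + 1\<close> divides \<open>y ^ 2 - 1\<close>, which
  divides every \<open>(y ^ 2) ^ n - 1\<close>.\<close>

lemma fermat_dvd:
  fixes i j :: nat
  assumes "i < j"
  shows "((2::int) ^ (2 ^ i)) ^ 2 + 1 dvd ((2 ^ (2 ^ j)) ^ 2 + 1) - 2"
proof -
  define y :: int where "y = (2 ^ (2 ^ i)) ^ 2"
  define d where "d = j - i - 1"
  have j: "j = i + (1 + d)" using assms by (simp add: d_def)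
  have "((2::int) ^ (2 ^ j)) ^ 2 = (y ^ 2) ^ (2 ^ d)"
    unfolding y_def j by (simp add: power_add flip: power_mult)
  moreover have "y ^ 2 - 1 dvd (y ^ 2) ^ (2 ^ d) - 1"
    by (metis dvd_triv_left power_diff_1_eq)
  moreover have "y ^ 2 - 1 = (y + 1) * (y - 1)" by (simp add: power2_eq_square algebra_simps)
  ultimately have "y + 1 dvd (2 ^ (2 ^ j)) ^ 2 - 1" by (metis dvd_mult_left)
  then show ?thesis by (simp add: y_def)
qed

text \<open>By \<open>fermat_dvd\<close> a common prime of two of these numbers would divide 2, but
  they are odd.\<close>

lemma fermat_prime_divisor_unique:
  fixes p :: int
  assumes p: "prime p" "p dvd (2 ^ (2 ^ i)) ^ 2 + 1" "p dvd (2 ^ (2 ^ j)) ^ 2 + 1"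
  shows "i = j"
proof (rule ccontr)
  have odd: "\<not> p dvd 2"
  proof
    assume "p dvd 2"
    then have "p dvd (2 ^ (2 ^ i)) ^ 2" by (meson dvd_power dvd_trans pos2 zero_less_power)
    then have "p dvd 1" using p(2) dvd_add_right_iff by blast
    then show False using p(1) not_prime_unit by blast
  qed
  assume "i \<noteq> j"
  then consider "i < j" | "j < i" by linarith
  then show False
  proof cases
    case 1
    then have "p dvd ((2 ^ (2 ^ j)) ^ 2 + 1) - 2" using fermat_dvd p(2) dvd_trans by blast
    then show False using odd p(3) by (metis dvd_diff_commute dvd_diff_right_iff)
  next
    case 2
    then have "p dvd ((2 ^ (2 ^ i)) ^ 2 + 1) - 2" using fermat_dvd p(3) dvd_trans by blast
    then show False using odd p(2) by (metis dvd_diff_commute dvd_diff_right_iff)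
  qed
qed

section \<open>Gaussian integers modulo a prime factor of a^2 + 1\<close>

definition gaussian :: "int \<Rightarrow> int \<Rightarrow> complex" where
  "gaussian x y = of_int x + of_int y * \<i>"

lemma gaussian_inject [simp]: "gaussian x y = gaussian x' y' \<longleftrightarrow> x = x' \<and> y = y'"
  by (simp add: gaussian_def complex_eq_iff)

lemma gaussian_mult: "gaussian x y * gaussian x' y' = gaussian (x * x' - y * y') (x * y' + y * x')"
  by (simp add: gaussian_def algebra_simps)

text \<open>If \<open>p\<close> divides \<open>a\<^sup>2 + 1\<close>, then \<open>x + iy \<mapsto> x - ay mod p\<close> is a ring
  homomorphism on the Gaussian integers with \<open>a + i \<mapsto> 0\<close>.
  These are the quotients of elements outside its kernel.\<close>
definition local_unit :: "int \<Rightarrow> int \<Rightarrow> complex \<Rightarrow> bool" where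
  "local_unit p a z \<longleftrightarrow> (\<exists>x y x' y'. \<not> p dvd x - a * y \<and> \<not> p dvd x' - a * y' \<and> z * gaussian x y = gaussian x' y')"

text \<open>The map sends \<open>\<i>\<close> to \<open>-a\<close>, whose square is
  \<open>-1\<close> modulo \<open>p\<close>, so it is multiplicative; its target is a field because
  \<open>p\<close> is prime.\<close>

lemma gaussian_dvd_mult_iff:
  fixes p :: int
  assumes "prime p" "p dvd a ^ 2 + 1"
  shows "p dvd (x * x' - y * y') - a * (x * y' + y * x') \<longleftrightarrow> p dvd x - a * y \<or> p dvd x' - a * y'"
proof -
  have "(x - a * y) * (x' - a * y') = ((x * x' - y * y') - a * (x * y' + y * x')) + (a ^ 2 + 1) * (y * y')"
    by (simp add: power2_eq_square algebra_simps)
  moreover have "p dvd (a ^ 2 + 1) * (y * y')" using assms(2) by simp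
  ultimately have "p dvd (x - a * y) * (x' - a * y') \<longleftrightarrow> p dvd (x * x' - y * y') - a * (x * y' + y * x')"
    by (simp only: dvd_add_left_iff)
  then show ?thesis using prime_dvd_mult_iff[OF assms(1)] by simp
qed

lemma local_unit_one: "prime (p::int) \<Longrightarrow> local_unit p a 1"
  unfolding local_unit_def by (intro exI[of _ 1] exI[of _ 0]) (auto simp: not_prime_unit)

lemma local_unit_mult:
  assumes p: "prime (p::int)" "p dvd a ^ 2 + 1" and "local_unit p a z" "local_unit p a w"
  shows "local_unit p a (z * w)"
proof -
  obtain x y x' y' where z: "\<not> p dvd x - a * y" "\<not> p dvd x' - a * y'" "z * gaussian x y = gaussian x' y'"
    using assms(3) by (auto simp: local_unit_def)
  obtain s t s' t' where w: "\<not> p dvd s - a * t" "\<not> p dvd s' - a * t'" "w * gaussian s t = gaussian s' t'"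
    using assms(4) by (auto simp: local_unit_def)
  have "(z * w) * (gaussian x y * gaussian s t) = gaussian x' y' * gaussian s' t'"
    unfolding z(3)[symmetric] w(3)[symmetric] by (simp add: mult_ac)
  then show ?thesis
    unfolding local_unit_def gaussian_mult using gaussian_dvd_mult_iff[OF p] z(1,2) w(1,2) by blast
qed

lemma local_unit_inverse:
  assumes "local_unit p a z"
  shows "local_unit p a (inverse z)"
proof -
  obtain x y x' y' where z: "\<not> p dvd x - a * y" "\<not> p dvd x' - a * y'" "z * gaussian x y = gaussian x' y'"
    using assms by (auto simp: local_unit_def)
  have "gaussian x' y' \<noteq> gaussian 0 0" using z(2) by auto
  then have "z \<noteq> 0" using z(3) by (auto simp: gaussian_def)
  then have "inverse z * gaussian x' y' = gaussian x y" by (simp flip: z(3))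
  then show ?thesis unfolding local_unit_def using z by blast
qed

lemma local_unit_power:
  assumes "prime (p::int)" "p dvd a ^ 2 + 1" "local_unit p a z"
  shows "local_unit p a (z ^ n)"
  by (induction n) (auto intro: local_unit_one local_unit_mult assms)

lemma local_unit_power_int:
  assumes "prime (p::int)" "p dvd a ^ 2 + 1" "local_unit p a z"
  shows "local_unit p a (z powi n)"
  using assms by (auto simp: power_int_def intro!: local_unit_power local_unit_inverse)

lemma local_unit_prod:
  assumes "prime (p::int)" "p dvd a ^ 2 + 1" "\<And>k. k \<in> S \<Longrightarrow> local_unit p a (f k)"
  shows "local_unit p a (\<Prod>k\<in>S. f k)"
  using assms(3) by (induction S rule: infinite_finite_induct) (auto intro: local_unit_one local_unit_mult assms)

lemma gaussian_power_dvd: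
  assumes "prime (p::int)" "p dvd a ^ 2 + 1" "0 < n"
  shows "\<exists>x' y'. gaussian x y ^ n = gaussian x' y' \<and> (p dvd x' - a * y' \<longleftrightarrow> p dvd x - a * y)"
  using assms(3)
proof (induction n)
  case (Suc n)
  show ?case
  proof (cases "n = 0")
    case False
    then obtain x' y' where "gaussian x y ^ n = gaussian x' y'" "p dvd x' - a * y' \<longleftrightarrow> p dvd x - a * y"
      using Suc.IH by auto
    then show ?thesis using gaussian_dvd_mult_iff[OF assms(1,2)] by (auto simp: gaussian_mult)
  qed auto
qed simp

lemma fermat_unit_gaussian:
  "fermat_unit j * gaussian (2 ^ (2 ^ j)) (- 1) = gaussian (2 ^ (2 ^ j)) 1"
  using fermat_unit_denom[of j] by (simp add: fermat_unit_def gaussian_def)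

text \<open>Choose a prime factor \<open>p\<close> of the norm \<open>a ^ 2 + 1\<close> belonging to
  index \<open>j\<close>. All other Fermat units are local units at \<open>p\<close>, so a relation
  would make a nonzero power of the \<open>j\<close>-th one local too. But reduction sends
  \<open>a + \<i>\<close> to 0 and \<open>a - \<i>\<close> to \<open>2 * a\<close>, which is nonzero
  modulo \<open>p\<close>.\<close>

lemma fermat_unit_independent:
  assumes j: "j \<in> {1..n}" "x j \<noteq> 0"
  shows "unit_monomial n x \<noteq> 1"
proof
  assume one: "unit_monomial n x = 1"
  define a :: int where "a = 2 ^ (2 ^ j)"
  have "a ^ 2 + 1 > 1" by (simp add: a_def)
  then obtain p where p: "prime p" "p dvd a ^ 2 + 1"
    using prime_factor_int[of "a ^ 2 + 1"] by auto
  note closed = local_unit_power_int[OF p] local_unit_prod[OF p]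
  have not_dvd: "\<not> p dvd a" "\<not> p dvd 2"
  proof -
    show *: "\<not> p dvd a"
    proof
      assume "p dvd a"
      then have "p dvd a ^ 2" by (simp add: dvd_power_iff power2_eq_square)
      then have "p dvd 1" using p(2) dvd_add_right_iff by blast
      then show False using p(1) not_prime_unit by blast
    qed
    show "\<not> p dvd 2"
    proof
      assume "p dvd 2"
      then have "p dvd a" unfolding a_def by (meson dvd_power dvd_trans pos2 zero_less_power)
      then show False using * by blast
    qed
  qed
  have others: "local_unit p a (fermat_unit k)" if "k \<noteq> j" for k
  proof -
    define b :: int where "b = 2 ^ (2 ^ k)"
    have "\<not> p dvd b ^ 2 + 1"
      using fermat_prime_divisor_unique[OF p(1), of j k] p(2) that by (auto simp: a_def b_def)
    \<comment> \<open>The reductions of \<open>b + \<i>\<close> and \<open>b - \<i>\<close> are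
      \<open>b - a\<close> and \<open>b + a\<close>; their product is a difference of two norms of
      which \<open>p\<close> divides only one.\<close>
    moreover have "(b - a) * (b + a) = (b ^ 2 + 1) - (a ^ 2 + 1)" by (simp add: power2_eq_square algebra_simps)
    ultimately have "\<not> p dvd (b - a) * (b + a)" using p(2) by (metis dvd_diff_left_iff)
    then have "\<not> p dvd b - a * 1" "\<not> p dvd b - a * (- 1)" by auto
    moreover have "fermat_unit k * gaussian b (- 1) = gaussian b 1"
      unfolding b_def by (rule fermat_unit_gaussian)
    ultimately show ?thesis unfolding local_unit_def by blast
  qed
  define R where "R = (\<Prod>k\<in>{1..n} - {j}. fermat_unit k powi x k)"
  have "local_unit p a R" unfolding R_def by (intro closed others) auto
  moreover have "fermat_unit j powi x j * R = 1"
    using one prod.remove[of "{1..n}" j "\<lambda>k. fermat_unit k powi x k"] j(1) by (simp add: unit_monomial_def R_def)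
  then have "inverse R = fermat_unit j powi x j" by (metis inverse_unique mult.commute)
  ultimately have L: "local_unit p a (fermat_unit j powi x j)" using local_unit_inverse by metis
  \<comment> \<open>A negative exponent is made positive by passing to the inverse, which is again a
    local unit.\<close>
  define m where "m = nat \<bar>x j\<bar>"
  have m: "0 < m" using j(2) by (simp add: m_def)
  have "local_unit p a (fermat_unit j ^ m)"
  proof (cases "x j \<ge> 0")
    case True
    then show ?thesis using L by (simp add: m_def power_int_def)
  next
    case False
    then show ?thesis using local_unit_inverse[OF L] by (simp add: m_def power_int_def power_inverse)
  qed
  then obtain s t s' t' where st: "\<not> p dvd s - a * t" "\<not> p dvd s' - a * t'"
    "fermat_unit j ^ m * gaussian s t = gaussian s' t'"
    by (auto simp: local_unit_def)
  obtain u v where uv: "gaussian a 1 ^ m = gaussian u v" "p dvd u - a * v"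
    using gaussian_power_dvd[OF p m, of a 1] by auto
  obtain u' v' where uv': "gaussian a (- 1) ^ m = gaussian u' v'" "\<not> p dvd u' - a * v'"
    using gaussian_power_dvd[OF p m, of a "- 1"] not_dvd prime_dvd_mult_iff[OF p(1), of 2 a] by auto
  have "fermat_unit j ^ m * gaussian u' v' = gaussian u v"
    unfolding uv(1)[symmetric] uv'(1)[symmetric] power_mult_distrib[symmetric]
    using fermat_unit_gaussian[of j] by (simp add: a_def)
  \<comment> \<open>After cross-multiplication the left side reduces to 0 through
    \<open>(a + \<i>) ^ m\<close>, while no factor on the right does.\<close>
  then have "gaussian u v * gaussian s t = gaussian s' t' * gaussian u' v'"
    unfolding st(3)[symmetric] by (metis mult.assoc mult.commute)
  then have "p dvd (u * s - v * t) - a * (u * t + v * s) \<longleftrightarrow> p dvd (s' * u' - t' * v') - a * (s' * v' + t' * u')"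
    unfolding gaussian_mult by simp
  then show False unfolding gaussian_dvd_mult_iff[OF p] using uv uv' st by blast
qed

text \<open>A number of modulus 1 on a coordinate axis has fourth power 1, but the fourth power here
  is the monomial with exponents \<open>4 * x k\<close>, excluded by independence.\<close>

lemma unit_monomial_nonaxis:
  assumes "j \<in> {1..n}" "x j \<noteq> 0"
  shows "Re (unit_monomial n x) \<noteq> 0" "Im (unit_monomial n x) \<noteq> 0"
proof -
  define z where "z = unit_monomial n x"
  have z4: "z ^ 4 \<noteq> 1"
    using fermat_unit_independent[of j n "\<lambda>k. x k * 4"] assms unit_monomial_power[of n x 4] by (simp add: z_def)
  have sq: "(Re z)\<^sup>2 + (Im z)\<^sup>2 = 1"
    using cmod_unit_monomial[of n x] by (simp add: z_def cmod_def)
  have z2: "z ^ 2 \<noteq> 1" "z ^ 2 \<noteq> - 1"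
  proof -
    have "z ^ 4 = (z ^ 2) ^ 2" by (simp flip: power_mult)
    then show "z ^ 2 \<noteq> 1" "z ^ 2 \<noteq> - 1" using z4 by (metis power_one power2_minus)+
  qed
  show "Re (unit_monomial n x) \<noteq> 0"
  proof
    assume "Re (unit_monomial n x) = 0"
    then have "z ^ 2 = - 1" using sq by (simp add: z_def complex_eq_iff power2_eq_square)
    then show False using z2 by simp
  qed
  show "Im (unit_monomial n x) \<noteq> 0"
  proof
    assume "Im (unit_monomial n x) = 0"
    then have "z ^ 2 = 1" using sq by (simp add: z_def complex_eq_iff power2_eq_square)
    then show False using z2 by simp
  qed
qed

section \<open>Reduced words in free products\<close>

definition reduced_word :: "('i \<Rightarrow> ('a, 'b) monoid_scheme) \<Rightarrow> ('i \<times> 'a) list \<Rightarrow> bool" where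
  "reduced_word G w \<longleftrightarrow> (\<forall>(i, x)\<in>set w. x \<noteq> \<one>\<^bsub>G i\<^esub>) \<and> distinct_adj (map fst w)"

lemma free_product_words_Cons [simp]:
  "(i, x) # w \<in> free_product_words I G \<longleftrightarrow> i \<in> I \<and> x \<in> carrier (G i) \<and> w \<in> free_product_words I G"
  by (auto simp: free_product_words_def)

lemma free_product_words_Nil [simp]: "[] \<in> free_product_words I G"
  by (simp add: free_product_words_def)

lemma free_product_words_append [simp]:
  "u @ v \<in> free_product_words I G \<longleftrightarrow> u \<in> free_product_words I G \<and> v \<in> free_product_words I G"
  by (auto simp: free_product_words_def)

lemma free_product_rel_Cons:
  assumes "i \<in> I" "x \<in> carrier (G i)" "(u, v) \<in> free_product_rel I G"
  shows "((i, x) # u, (i, x) # v) \<in> free_product_rel I G"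
proof -
  have "([(i, x)], [(i, x)]) \<in> free_product_rel I G"
    using assms by (intro free_product_rel.refl) simp
  from free_product_rel.append[OF this assms(3)] show ?thesis by simp
qed

lemma free_product_rel_drop_one:
  assumes "i \<in> I" "w \<in> free_product_words I G"
  shows "((i, \<one>\<^bsub>G i\<^esub>) # w, w) \<in> free_product_rel I G"
  using free_product_rel.append[OF free_product_rel.one free_product_rel.refl, OF assms] by simp

lemma free_product_rel_merge:
  assumes "i \<in> I" "x \<in> carrier (G i)" "y \<in> carrier (G i)" "w \<in> free_product_words I G"
  shows "((i, x) # (i, y) # w, (i, x \<otimes>\<^bsub>G i\<^esub> y) # w) \<in> free_product_rel I G"
  using free_product_rel.append[OF free_product_rel.mult free_product_rel.refl, OF assms] by simp

text \<open>Prepend letters one at a time to a reduced word: an identity letter is dropped, a letter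
  from the factor of the head is merged with it, and a merged letter that becomes the identity
  disappears, leaving a reduced tail.\<close>

lemma exists_reduced_word:
  assumes G: "\<And>i. i \<in> I \<Longrightarrow> group (G i)" and "w \<in> free_product_words I G"
  shows "\<exists>v\<in>free_product_words I G. reduced_word G v \<and> (w, v) \<in> free_product_rel I G"
  using assms(2)
proof (induction w)
  case Nil
  show ?case by (intro bexI[of _ "[]"]) (auto simp: reduced_word_def intro: free_product_rel.refl)
next
  case (Cons a w)
  obtain i x where a: "a = (i, x)" by (cases a)
  have ix: "i \<in> I" "x \<in> carrier (G i)" and w: "w \<in> free_product_words I G"
    using Cons.prems by (auto simp: a)
  interpret Gi: group "G i" using G ix by blast
  obtain v where v: "v \<in> free_product_words I G" "reduced_word G v" "(w, v) \<in> free_product_rel I G"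
    using Cons.IH[OF w] by blast
  have step: "(a # w, (i, x) # v) \<in> free_product_rel I G"
    unfolding a using free_product_rel_Cons ix v(3) by metis
  show ?case
  proof (cases "x = \<one>\<^bsub>G i\<^esub>")
    case True
    then have "(a # w, v) \<in> free_product_rel I G"
      using free_product_rel.trans[OF step] free_product_rel_drop_one[of i I v G] ix v by blast
    then show ?thesis using v by blast
  next
    case x1: False
    show ?thesis
    proof (cases "v = [] \<or> fst (hd v) \<noteq> i")
      case True
      then have "reduced_word G ((i, x) # v)"
        using v(2) x1 by (auto simp: reduced_word_def distinct_adj_Cons hd_map)
      then show ?thesis using step v ix by (intro bexI[of _ "(i, x) # v"]) auto
    next
      case False
      then obtain y v' where v': "v = (i, y) # v'" by (cases v) auto
      have y: "y \<in> carrier (G i)" "v' \<in> free_product_words I G" using v(1) by (auto simp: v')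
      have step': "(a # w, (i, x \<otimes>\<^bsub>G i\<^esub> y) # v') \<in> free_product_rel I G"
        using free_product_rel.trans[OF step] free_product_rel_merge[of i I x G y v'] ix y v' by blast
      have red: "reduced_word G v'"
        using v(2) by (auto simp: reduced_word_def v' dest: distinct_adj_ConsD)
      show ?thesis
      proof (cases "x \<otimes>\<^bsub>G i\<^esub> y = \<one>\<^bsub>G i\<^esub>")
        case True
        then have "(a # w, v') \<in> free_product_rel I G"
          using free_product_rel.trans[OF step'] free_product_rel_drop_one[of i I v' G] ix y by simp
        then show ?thesis using red y by blast
      next
        case False
        then have "reduced_word G ((i, x \<otimes>\<^bsub>G i\<^esub> y) # v')"
          using v(2) by (auto simp: reduced_word_def v' distinct_adj_Cons)
        then show ?thesis using step' ix y by (intro bexI[of _ "(i, x \<otimes>\<^bsub>G i\<^esub> y) # v'"]) auto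
      qed
    qed
  qed
qed

definition word_eval :: "('c, 'd) monoid_scheme \<Rightarrow> ('i \<Rightarrow> 'a \<Rightarrow> 'c) \<Rightarrow> ('i \<times> 'a) list \<Rightarrow> 'c" where
  "word_eval M f w = foldr (\<lambda>(i, x). (\<otimes>\<^bsub>M\<^esub>) (f i x)) w \<one>\<^bsub>M\<^esub>"

text \<open>The map of the universal property, computed on an arbitrary representative;
  \<open>word_eval_rel\<close> shows that the choice does not matter.\<close>

definition free_product_lift :: "('c, 'd) monoid_scheme \<Rightarrow> ('i \<Rightarrow> 'a \<Rightarrow> 'c) \<Rightarrow> ('i \<times> 'a) list set \<Rightarrow> 'c" where
  "free_product_lift M f A = word_eval M f (SOME w. w \<in> A)"

text \<open>The target is only a monoid, so preservation of the identity does not follow from the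
  homomorphism property and is assumed separately.\<close>

context
  fixes I :: "'i set" and G :: "'i \<Rightarrow> ('a, 'b) monoid_scheme" and M :: "('c, 'd) monoid_scheme"
    and f :: "'i \<Rightarrow> 'a \<Rightarrow> 'c"
  assumes G: "\<And>i. i \<in> I \<Longrightarrow> group (G i)" and M: "Group.monoid M"
    and f_hom: "\<And>i. i \<in> I \<Longrightarrow> f i \<in> hom (G i) M"
    and f_one: "\<And>i. i \<in> I \<Longrightarrow> f i \<one>\<^bsub>G i\<^esub> = \<one>\<^bsub>M\<^esub>"
begin

interpretation M: Group.monoid M by (rule M)

lemma word_eval_closed: "w \<in> free_product_words I G \<Longrightarrow> word_eval M f w \<in> carrier M"
proof (induction w)
  case (Cons a w)
  then show ?case
    using f_hom by (cases a) (auto simp: word_eval_def intro!: M.m_closed dest: hom_in_carrier)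
qed (simp add: word_eval_def)

lemma word_eval_append:
  "u \<in> free_product_words I G \<Longrightarrow> v \<in> free_product_words I G
    \<Longrightarrow> word_eval M f (u @ v) = word_eval M f u \<otimes>\<^bsub>M\<^esub> word_eval M f v"
proof (induction u)
  case Nil
  then show ?case using word_eval_closed[of v] by (simp add: word_eval_def)
next
  case (Cons a u)
  obtain i x where a: "a = (i, x)" by (cases a)
  have "f i x \<in> carrier M" using Cons.prems f_hom by (auto simp: a dest: hom_in_carrier)
  then show ?case
    using Cons word_eval_closed[of u] word_eval_closed[of v] M.m_assoc
    by (auto simp: a word_eval_def)
qed

lemma word_eval_rel:
  assumes "(u, v) \<in> free_product_rel I G"
  shows "word_eval M f u = word_eval M f v"
  using assms
proof induction
  case (append u u' v v')
  then show ?case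
    using free_product_rel_words[of I G] G by (simp add: word_eval_append)
next
  case (one i)
  then show ?case using f_one by (simp add: word_eval_def)
next
  case (mult i x y)
  then have "f i x \<in> carrier M" "f i y \<in> carrier M" "f i (x \<otimes>\<^bsub>G i\<^esub> y) = f i x \<otimes>\<^bsub>M\<^esub> f i y"
    using f_hom by (auto dest: hom_in_carrier hom_mult)
  then show ?case by (simp add: word_eval_def)
qed auto

lemma free_product_lift_class:
  assumes "w \<in> free_product_words I G"
  shows "free_product_lift M f (free_product_rel I G `` {w}) = word_eval M f w"
proof -
  have "w \<in> free_product_rel I G `` {w}" using assms by (auto intro: free_product_rel.refl)
  then have "(SOME v. v \<in> free_product_rel I G `` {w}) \<in> free_product_rel I G `` {w}" by (rule someI)
  then show ?thesis unfolding free_product_lift_def using word_eval_rel[of w] by simp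
qed

lemma free_product_carrierE:
  assumes "A \<in> carrier (free_product I G)"
  obtains w where "w \<in> free_product_words I G" "A = free_product_rel I G `` {w}"
  using assms by (auto simp: free_product_def elim: quotientE)

lemma free_product_lift_hom: "free_product_lift M f \<in> hom (free_product I G) M"
proof (rule homI)
  fix A B assume A: "A \<in> carrier (free_product I G)" and B: "B \<in> carrier (free_product I G)"
  obtain u where u: "u \<in> free_product_words I G" "A = free_product_rel I G `` {u}"
    by (rule free_product_carrierE[OF A])
  obtain v where v: "v \<in> free_product_words I G" "B = free_product_rel I G `` {v}"
    by (rule free_product_carrierE[OF B])
  show "free_product_lift M f A \<in> carrier M"
    unfolding u(2) free_product_lift_class[OF u(1)] by (rule word_eval_closed[OF u(1)])
  have AB: "A \<otimes>\<^bsub>free_product I G\<^esub> B = free_product_rel I G `` {u @ v}"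
    unfolding u(2) v(2) using G u(1) v(1) by (rule free_product_mult_class)
  have "free_product_lift M f (A \<otimes>\<^bsub>free_product I G\<^esub> B) = word_eval M f (u @ v)"
    unfolding AB using u(1) v(1) by (intro free_product_lift_class) simp
  then show "free_product_lift M f (A \<otimes>\<^bsub>free_product I G\<^esub> B) = free_product_lift M f A \<otimes>\<^bsub>M\<^esub> free_product_lift M f B"
    unfolding u(2) v(2) using u(1) v(1) by (simp add: free_product_lift_class word_eval_append)
qed

lemma free_product_reduced_cases:
  assumes "A \<in> carrier (free_product I G)"
  obtains w where "w \<in> free_product_words I G" "reduced_word G w" "A = free_product_rel I G `` {w}"
    "free_product_lift M f A = word_eval M f w" "A \<noteq> \<one>\<^bsub>free_product I G\<^esub> \<Longrightarrow> w \<noteq> []"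
proof -
  obtain u where u: "u \<in> free_product_words I G" "A = free_product_rel I G `` {u}"
    by (rule free_product_carrierE[OF assms])
  obtain w where w: "w \<in> free_product_words I G" "reduced_word G w" "(u, w) \<in> free_product_rel I G"
    using exists_reduced_word[OF G u(1)] by blast
  have A: "A = free_product_rel I G `` {w}"
    using equiv_class_eq[OF equiv_free_product_rel w(3)] G u(2) by simp
  moreover have "free_product_lift M f A = word_eval M f w"
    unfolding A by (rule free_product_lift_class[OF w(1)])
  moreover have "w \<noteq> []" if "A \<noteq> \<one>\<^bsub>free_product I G\<^esub>"
    using that by (auto simp: A free_product_def)
  ultimately show ?thesis using w that by blast
qed

end

section \<open>Representations of free products\<close>

definition letter_rep :: "(nat \<Rightarrow> nat) \<Rightarrow> nat \<Rightarrow> (nat \<Rightarrow> int) \<Rightarrow> complex mat" where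
  "letter_rep r j x = twisted_rotation j (unit_monomial (r j) x)"

definition free_product_rep :: "(nat \<Rightarrow> nat) \<Rightarrow> (nat \<times> (nat \<Rightarrow> int)) list set \<Rightarrow> complex mat" where
  "free_product_rep r = free_product_lift (unitary_group 2) (letter_rep r)"

lemma group_free_abelian_power: "group (free_abelian_power n)"
  by (simp add: free_abelian_power_def group_integer_group)

lemma one_free_abelian_power: "\<one>\<^bsub>free_abelian_power n\<^esub> = (\<lambda>k\<in>{1..n}. 0)"
  by (simp add: free_abelian_power_def)

lemma letter_rep_hom: "letter_rep r j \<in> hom (free_abelian_power (r j)) (unitary_group 2)"
proof (rule homI)
  fix x y :: "nat \<Rightarrow> int"
  show "letter_rep r j x \<in> carrier (unitary_group 2)"
    by (simp add: letter_rep_def twisted_rotation_unitary cmod_unit_monomial)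
  have "unit_monomial (r j) (x \<otimes>\<^bsub>free_abelian_power (r j)\<^esub> y) = unit_monomial (r j) x * unit_monomial (r j) y"
    by (rule unit_monomial_add) (simp add: free_abelian_power_def)
  then show "letter_rep r j (x \<otimes>\<^bsub>free_abelian_power (r j)\<^esub> y) = letter_rep r j x \<otimes>\<^bsub>unitary_group 2\<^esub> letter_rep r j y"
    by (simp add: letter_rep_def unitary_group_def twisted_rotation_mult)
qed

lemma letter_rep_one: "letter_rep r j \<one>\<^bsub>free_abelian_power (r j)\<^esub> = \<one>\<^bsub>unitary_group 2\<^esub>"
  by (simp add: letter_rep_def one_free_abelian_power unit_monomial_def unitary_group_def twisted_rotation_one)

lemmas free_product_rep_rules =
  group_free_abelian_power monoid_unitary_group letter_rep_hom letter_rep_one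

lemma free_product_rep_hom:
  "free_product_rep r \<in> hom (free_product I (\<lambda>j. free_abelian_power (r j))) (unitary_group 2)"
  unfolding free_product_rep_def by (intro free_product_lift_hom free_product_rep_rules)

lemma word_eval_rotation_word:
  "word_eval (unitary_group 2) (letter_rep r) w = rotation_word (map (\<lambda>(j, x). (j, unit_monomial (r j) x)) w)"
  by (induction w) (auto simp: word_eval_def rotation_word_def unitary_group_def letter_rep_def)

text \<open>A nontrivial element has a nonempty reduced word. Its letters become rotations off the
  axes with distinct neighbouring twists, so the image has a nonzero off-diagonal entry.\<close>

lemma free_product_rep_character:
  assumes A: "A \<in> carrier (free_product I (\<lambda>j. free_abelian_power (r j)))"
    "A \<noteq> \<one>\<^bsub>free_product I (\<lambda>j. free_abelian_power (r j))\<^esub>"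
  shows "cmod (rep_character (free_product_rep r) A) < 2"
proof -
  let ?G = "\<lambda>j. free_abelian_power (r j)"
  obtain w where w: "w \<in> free_product_words I ?G" "reduced_word ?G w" "w \<noteq> []"
    and lift: "free_product_rep r A = word_eval (unitary_group 2) (letter_rep r) w"
    using free_product_reduced_cases[of I ?G "unitary_group 2" "letter_rep r", OF free_product_rep_rules A(1)] A(2)
    unfolding free_product_rep_def by metis
  define ws where "ws = map (\<lambda>(j, x). (j, unit_monomial (r j) x)) w"
  have "rotation_word ws $$ (0, 1) \<noteq> 0"
  proof (rule rotation_word_off_diagonal)
    have map_fst: "map fst ws = map fst w" by (simp add: ws_def o_def case_prod_unfold)
    show "distinct_adj (map fst ws)" unfolding map_fst using w(2) by (simp add: reduced_word_def)
    show "ws \<noteq> []" using w(3) by (simp add: ws_def)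
    fix a assume "a \<in> set ws"
    then obtain j x where jx: "(j, x) \<in> set w" "snd a = unit_monomial (r j) x" by (auto simp: ws_def)
    then have "x \<in> carrier (?G j)" "x \<noteq> \<one>\<^bsub>?G j\<^esub>"
      using w by (auto simp: reduced_word_def free_product_words_def)
    \<comment> \<open>Elements of the factor are functions restricted to \<open>{1..r j}\<close>, so
      one that differs from the identity has a nonzero exponent in this range.\<close>
    then obtain k where "k \<in> {1..r j}" "x k \<noteq> 0"
      using PiE_ext[of x "{1..r j}" "\<lambda>_. UNIV" "\<lambda>k\<in>{1..r j}. 0"]
      by (auto simp: one_free_abelian_power free_abelian_power_def)
    then show "Re (snd a) \<in> \<rat> \<and> Im (snd a) \<in> \<rat> \<and> Re (snd a) \<noteq> 0 \<and> Im (snd a) \<noteq> 0"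
      using gaussian_rat_unit_monomial[of "r j" x] unit_monomial_nonaxis[of k "r j" x]
      by (simp add: jx gaussian_rat_def)
  qed
  moreover have "free_product_rep r A \<in> carrier (unitary_group 2)"
    using free_product_rep_hom A(1) by (rule hom_in_carrier)
  ultimately show ?thesis
    unfolding rep_character_def by (intro unitary_trace_less_2) (simp_all add: lift word_eval_rotation_word ws_def)
qed

section \<open>Factorization of the images over Ctilde\<close>

lemma foldr_mat_mult_append:
  fixes Ms :: "'a::comm_ring_1 mat list"
  assumes "set Ms \<subseteq> carrier_mat n n" "set Ns \<subseteq> carrier_mat n n"
  shows "foldr (*) (Ms @ Ns) (1\<^sub>m n) = foldr (*) Ms (1\<^sub>m n) * foldr (*) Ns (1\<^sub>m n)"
proof -
  have carr: "foldr (*) Ms (1\<^sub>m n) \<in> carrier_mat n n" if "set Ms \<subseteq> carrier_mat n n" for Ms :: "'a mat list"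
    using that by (induction Ms) (auto intro!: mult_carrier_mat[where n = n])
  show ?thesis
    using assms(1)
  proof (induction Ms)
    case Nil
    then show ?case using carr[OF assms(2)] by simp
  next
    case (Cons M Ms)
    then show ?case
      using carr[OF assms(2)] carr[of Ms] assoc_mult_mat[of M n n "foldr (*) Ms (1\<^sub>m n)" n "foldr (*) Ns (1\<^sub>m n)" n]
      by simp
  qed
qed

lemma unitary_matrices_over_carrier: "unitary_matrices_over n A \<subseteq> carrier_mat n n"
  by (auto simp: unitary_matrices_over_def unitary_group_def)

lemma rotation_word_factors:
  assumes "\<And>w. w \<in> set ws \<Longrightarrow> cmod (snd w) = 1 \<and> Re (snd w) \<in> \<rat> \<and> Im (snd w) \<in> \<rat>"
  shows "\<exists>Ms. set Ms \<subseteq> unitary_matrices_over 2 Ctilde \<and> rotation_word ws = foldr (*) Ms (1\<^sub>m 2)"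
  using assms
proof (induction ws)
  case Nil
  show ?case by (intro exI[of _ "[]"]) (simp add: rotation_word_def)
next
  case (Cons a ws)
  obtain j u where a: "a = (j, u)" by (cases a)
  obtain Ms where Ms: "set Ms \<subseteq> unitary_matrices_over 2 Ctilde" "rotation_word ws = foldr (*) Ms (1\<^sub>m 2)"
    using Cons.IH Cons.prems by (meson list.set_intros(2))
  have u: "cmod u = 1" "Re u \<in> \<rat>" "Im u \<in> \<rat>" using Cons.prems[of a] by (auto simp: a)
  note fac = twisted_rotation_factors[OF u, of j]
  have "rotation_word (a # ws) = twisted_rotation j u * rotation_word ws"
    by (simp add: rotation_word_def a)
  also have "\<dots> = foldr (*) (twisted_rotation_factors j u @ Ms) (1\<^sub>m 2)"
    unfolding Ms(2) fac(2)[symmetric]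
    by (rule foldr_mat_mult_append[symmetric]) (use fac(1) Ms(1) unitary_matrices_over_carrier in blast)+
  finally show ?case using fac(1) Ms(1) by (intro exI[of _ "twisted_rotation_factors j u @ Ms"]) simp
qed

text \<open>Since this covers every element, any generating set and its inverses will satisfy the
  condition on matrix entries.\<close>

lemma free_product_rep_factors:
  assumes "A \<in> carrier (free_product I (\<lambda>j. free_abelian_power (r j)))"
  shows "\<exists>Ms. set Ms \<subseteq> unitary_matrices_over 2 Ctilde \<and> free_product_rep r A = foldr (*) Ms (1\<^sub>m 2)"
proof -
  obtain w where "free_product_rep r A = word_eval (unitary_group 2) (letter_rep r) w"
    using free_product_reduced_cases[of I "\<lambda>j. free_abelian_power (r j)" "unitary_group 2" "letter_rep r",
        OF free_product_rep_rules assms]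
    unfolding free_product_rep_def by metis
  moreover have "\<exists>Ms. set Ms \<subseteq> unitary_matrices_over 2 Ctilde
    \<and> word_eval (unitary_group 2) (letter_rep r) w = foldr (*) Ms (1\<^sub>m 2)"
    unfolding word_eval_rotation_word
  proof (rule rotation_word_factors)
    fix a assume "a \<in> set (map (\<lambda>(j, x). (j, unit_monomial (r j) x)) w)"
    then show "cmod (snd a) = 1 \<and> Re (snd a) \<in> \<rat> \<and> Im (snd a) \<in> \<rat>"
      using gaussian_rat_unit_monomial by (auto simp: gaussian_rat_def cmod_unit_monomial)
  qed
  ultimately show ?thesis by simp
qed

section \<open>Transfer to the finite-index subgroup\<close>

lemma finitely_generated_group_iso:
  assumes A: "group A" and B: "finitely_generated_group B" and iso: "A \<cong> B"
  shows "\<exists>S. finite S \<and> generating_set A S"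
proof -
  have gB: "group B" using B by (simp add: finitely_generated_group_def)
  obtain S where S: "finite S" "S \<subseteq> carrier B" "generate B S = carrier B"
    using B by (auto simp: finitely_generated_group_def generating_set_def)
  have "B \<cong> A" by (rule group.iso_sym[OF A iso])
  then obtain g where g: "g \<in> iso B A" by (auto simp: is_iso_def)
  then have hom: "g \<in> hom B A" and bij: "g ` carrier B = carrier A"
    by (auto simp: iso_def bij_betw_def)
  interpret g: group_hom B A g using A gB hom by (simp add: group_hom_def group_hom_axioms_def)
  have gS: "g ` S \<subseteq> carrier A" using S(2) bij by blast
  have "g x \<in> generate A (g ` S)" if "x \<in> generate B S" for x
    using that
  proof induction
    case (inv h)
    then have "inv\<^bsub>A\<^esub> g h \<in> generate A (g ` S)" by (intro generate.inv) blast
    then show ?case using inv S(2) by (simp add: subset_iff)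
  next
    case (eng h1 h2)
    then have "h1 \<in> carrier B" "h2 \<in> carrier B" using S(3) by auto
    then show ?case using eng by (simp add: generate.eng)
  qed (auto intro: generate.intros)
  then have "g ` generate B S \<subseteq> generate A (g ` S)" by (rule image_subsetI)
  then have "carrier A \<subseteq> generate A (g ` S)" by (simp only: S(3) bij)
  then have "generate A (g ` S) = carrier A" using g.H.generate_incl[OF gS] by (rule equalityI[rotated])
  then show ?thesis using S(1) gS by (intro exI[of _ "g ` S"]) (simp add: generating_set_def)
qed

theorem theorem10:
  fixes G :: "('a, 'b) monoid_scheme"
    and t :: nat and m :: "nat \<Rightarrow> nat" and r :: "nat \<Rightarrow> nat \<Rightarrow> nat"
    and H :: "nat \<Rightarrow> (nat \<times> (nat \<Rightarrow> int)) list set monoid"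
    and L :: "'a set" and P :: "(nat \<Rightarrow> (nat \<times> (nat \<Rightarrow> int)) list set) set"
  assumes G: "finitely_generated_group G"
    and H: "\<And>i. i \<in> {1..t} \<Longrightarrow>
      H i = free_product {1..m i} (\<lambda>j. free_abelian_power (r i j))"
    and L: "finite_index_subgroup L G"
    and P: "subgroup P (product_group {1..t} H)"
      "finitely_generated_group ((product_group {1..t} H)\<lparr>carrier := P\<rparr>)"
    and iso: "G\<lparr>carrier := L\<rparr> \<cong> (product_group {1..t} H)\<lparr>carrier := P\<rparr>"
  shows "\<exists>k\<ge>1. \<exists>K S \<rho>. finite_index_subgroup K G \<and>
    unbounded_error_DFR k 2 Ctilde (G\<lparr>carrier := K\<rparr>) S \<rho>"
proof -
  let ?PG = "product_group {1..t} H" and ?K = "G\<lparr>carrier := L\<rparr>"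
  have K: "group ?K"
    using L G by (auto simp: finite_index_subgroup_def finitely_generated_group_def intro: subgroup.subgroup_is_group)
  \<comment> \<open>The subgroup \<open>L\<close> itself serves as \<open>K\<close>; its generators
    are pulled back from \<open>P\<close> along the isomorphism.\<close>
  obtain S where S: "finite S" "generating_set ?K S"
    using finitely_generated_group_iso[OF K P(2) iso] by blast
  obtain h where h: "h \<in> iso ?K (?PG\<lparr>carrier := P\<rparr>)"
    using iso by (auto simp: is_iso_def)
  have PG: "P \<subseteq> (\<Pi>\<^sub>E i\<in>{1..t}. carrier (H i))"
    using subgroup.subset[OF P(1)] by simp
  have h_carrier: "h x \<in> (\<Pi>\<^sub>E i\<in>{1..t}. carrier (H i))" if "x \<in> L" for x
    using h that PG by (auto simp: iso_def hom_def)
  have h_mult: "h (x \<otimes>\<^bsub>G\<^esub> y) i = h x i \<otimes>\<^bsub>H i\<^esub> h y i" if "x \<in> L" "y \<in> L" "i \<in> {1..t}" for x y i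
    using h that by (auto simp: iso_def hom_def)
  have h_one: "x = \<one>\<^bsub>G\<^esub>" if x: "x \<in> L" "h x = (\<lambda>i\<in>{1..t}. \<one>\<^bsub>H i\<^esub>)" for x
  proof -
    have "group (?PG\<lparr>carrier := P\<rparr>)" using P(2) by (simp add: finitely_generated_group_def)
    then interpret h: group_hom ?K "?PG\<lparr>carrier := P\<rparr>" h
      using K h by (simp add: group_hom_def group_hom_axioms_def iso_def)
    have "h \<one>\<^bsub>?K\<^esub> = h x" using h.hom_one x(2) by simp
    moreover have "inj_on h L" using h by (simp add: iso_def bij_betw_def)
    moreover have "\<one>\<^bsub>?K\<^esub> \<in> L" using Group.monoid.one_closed[OF group.is_monoid[OF K]] by simp
    ultimately show ?thesis using x(1) by (auto dest: inj_onD)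
  qed
  \<comment> \<open>For \<open>i\<close> in \<open>{1..t}\<close> this is the \<open>i\<close>-th
    coordinate of \<open>h\<close> followed by the representation of \<open>H i\<close>. The index
    \<open>Suc t\<close> carries the trivial representation, which keeps the family nonempty when
    \<open>t = 0\<close>.\<close>
  define \<rho> where "\<rho> = (\<lambda>i x. if i \<le> t then free_product_rep (r i) (h x i) else 1\<^sub>m 2)"
  have one_closed: "1\<^sub>m 2 \<in> carrier (unitary_group 2)"
    using Group.monoid.one_closed[OF monoid_unitary_group[of 2]] by (simp add: unitary_group_def)
  have "\<rho> i \<in> hom ?K (unitary_group 2)" if i: "i \<in> {1..Suc t}" for i
  proof (cases "i \<le> t")
    case True
    then have i: "i \<in> {1..t}" using i by simp
    have hom: "free_product_rep (r i) \<in> hom (H i) (unitary_group 2)"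
      unfolding H[OF i] by (rule free_product_rep_hom)
    show ?thesis
    proof (rule homI)
      fix x y assume "x \<in> carrier ?K" "y \<in> carrier ?K"
      then have xy: "x \<in> L" "y \<in> L" by auto
      then have c: "h x i \<in> carrier (H i)" "h y i \<in> carrier (H i)" using h_carrier i by blast+
      show "\<rho> i x \<in> carrier (unitary_group 2)"
        using hom_in_carrier[OF hom c(1)] True by (simp add: \<rho>_def)
      show "\<rho> i (x \<otimes>\<^bsub>?K\<^esub> y) = \<rho> i x \<otimes>\<^bsub>unitary_group 2\<^esub> \<rho> i y"
        using hom_mult[OF hom c] True h_mult[OF xy i] by (simp add: \<rho>_def)
    qed
  next
    case False
    then show ?thesis using one_closed by (intro homI) (auto simp: \<rho>_def unitary_group_def)
  qed
  moreover have "\<exists>i\<in>{1..Suc t}. cmod (rep_character (\<rho> i) x) < real 2"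
    if x: "x \<in> carrier ?K" "x \<noteq> \<one>\<^bsub>?K\<^esub>" for x
  proof -
    have hx: "h x \<in> (\<Pi>\<^sub>E i\<in>{1..t}. carrier (H i))" using h_carrier x(1) by simp
    have "h x \<noteq> (\<lambda>i\<in>{1..t}. \<one>\<^bsub>H i\<^esub>)" using h_one x by auto
    \<comment> \<open>Injectivity of \<open>h\<close> leaves some coordinate nontrivial, and the
      representation of that factor detects it.\<close>
    then obtain i where i: "i \<in> {1..t}" "h x i \<noteq> \<one>\<^bsub>H i\<^esub>"
      using hx by (metis PiE_restrict restrict_ext)
    have "cmod (rep_character (free_product_rep (r i)) (h x i)) < 2"
      using i PiE_mem[OF hx i(1)] unfolding H[OF i(1)] by (intro free_product_rep_character) auto
    then show ?thesis using i(1) by (intro bexI[of _ i]) (auto simp: \<rho>_def rep_character_def)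
  qed
  moreover have "\<exists>Ms. set Ms \<subseteq> unitary_matrices_over 2 Ctilde \<and> \<rho> i \<sigma> = foldr (*) Ms (1\<^sub>m 2)"
    if \<sigma>: "\<sigma> \<in> S \<union> m_inv ?K ` S" and i: "i \<in> {1..Suc t}" for \<sigma> i
  proof (cases "i \<le> t")
    case True
    then have i: "i \<in> {1..t}" using i by simp
    have "S \<subseteq> carrier ?K" using S(2) by (simp add: generating_set_def)
    then have "\<sigma> \<in> carrier ?K" using \<sigma> group.inv_closed[OF K] by blast
    then have "\<sigma> \<in> L" by simp
    then have "h \<sigma> i \<in> carrier (H i)" by (rule PiE_mem[OF h_carrier i])
    then show ?thesis
      unfolding H[OF i] using free_product_rep_factors True by (simp add: \<rho>_def)
  next
    case False
    then show ?thesis by (intro exI[of _ "[]"]) (simp add: \<rho>_def)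
  qed
  ultimately have "unbounded_error_DFR (Suc t) 2 Ctilde ?K S \<rho>"
    unfolding unbounded_error_DFR_def using K S by auto
  then show ?thesis using L by (intro exI[of _ "Suc t"] conjI exI[of _ L] exI[of _ S] exI[of _ \<rho>]) auto
qed

end
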